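(* Let $n\ge 1$ and let $$N_n(x,y,z)=\sum_{\sigma\in\mathcal{Q}_n}x^{\mathrm{lap}(\sigma)}y^{\mathrm{eud}(\sigma)}z^{\mathrm{rpd}(\sigma)}.$$ Then $$N_n(x,y,z)=\sum_{i+2j+3k=2n+1}3^i\,\gamma_{n,i,j,k}\,(x+y+z)^j(xyz)^k,$$ where the sum is over nonnegative integers $i,j,k$ with $i+2j+3k=2n+1$, and $\gamma_{n,i,j,k}$ equals the number of 0-1-2-3 increasing plane trees on $[n]$ with $k$ leaves, $j$ degree one vertices and $i$ degree two vertices.
   Context: $\mathcal{Q}_n$ is the set of Stirling permutations of order $n$: words $\sigma=\sigma_1\cdots\sigma_{2n}$ that are arrangements of the multiset $\{1,1,2,2,\ldots,n,n\}$ such that whenever $i<s<j$ and $\sigma_i=\sigma_j$ one has $\sigma_s\ge\sigma_i$. Set $\sigma_0=\sigma_{2n+1}=0$. - $\mathrm{lap}(\sigma)$ is the number of $i\in\{1,\ldots,2n-1\}$ with $\sigma_{i-1}<\sigma_i=\sigma_{i+1}$ (left ascent-plateaux). - $\mathrm{rpd}(\sigma)$ is the number of $i\in\{2,\ldots,2n\}$ with $\sigma_{i-1}=\sigma_i>\sigma_{i+1}$ (right plateau-descents). - $\mathrm{eud}(\sigma)$ is the number of $i\in\{1,\ldots,2n-1\}$ such that $\sigma_{i-1}<\sigma_i=\sigma_j>\sigma_{j+1}$ for some $j>i$ (exterior up-down-pairs). An increasing plane tree on $[n]=\{1,\ldots,n\}$ is a rooted tree with vertices labelled bijectively by $1,\ldots,n$,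 with root $1$, labels increasing along every path from the root, and the children of each vertex linearly ordered. The degree of a vertex is its number of children; a leaf is a vertex of degree $0$. A 0-1-2-3 increasing plane tree is an increasing plane tree in which every vertex has at most three children. In the paper the $\gamma_{n,i,j,k}$ are the same coefficients as those in the known expansion $$\sum_{\sigma\in\mathcal{Q}_n}x^{\mathrm{asc}(\sigma)}y^{\mathrm{des}(\sigma)}z^{\mathrm{plat}(\sigma)}=\sum_{i+2j+3k=2n+1}\gamma_{n,i,j,k}(x+y+z)^i(xy+yz+zx)^j(xyz)^k,$$ where $\mathrm{asc},\mathrm{des},\mathrm{plat}$ count the indices $i\in\{0,\ldots,2n\}$ with $\sigma_i<\sigma_{i+1}$, $\sigma_i>\sigma_{i+1}$, $\sigma_i=\sigma_{i+1}$, respectively. *)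

theory Defs
  imports Complex_Main "HOL-Library.Multiset"
begin

text \<open>
  Words are 0-based lists, but all definitions below use the 1-based letters
  \<open>letter \<sigma> 1, \<dots>, letter \<sigma> (length \<sigma>)\<close>, padded with a zero at position \<open>0\<close> and
  at position \<open>length \<sigma> + 1\<close>. A Stirling permutation of order \<open>n\<close> has
  \<open>length \<sigma> = 2 * n\<close>. Positions outside this range are never inspected.
\<close>

definition letter :: "nat list \<Rightarrow> nat \<Rightarrow> nat" where
  "letter \<sigma> i = (0 # \<sigma> @ [0]) ! i"

definition stirling_perms :: "nat \<Rightarrow> nat list set" where
  "stirling_perms n =
    {\<sigma>. mset \<sigma> = mset_set {1..n} + mset_set {1..n} \<and>
         (\<forall>i s j. 1 \<le> i \<and> i < s \<and> s < j \<and> j \<le> length \<sigma> \<and> letter \<sigma> i = letter \<sigma> j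
            \<longrightarrow> letter \<sigma> s \<ge> letter \<sigma> i)}"

definition lap :: "nat list \<Rightarrow> nat" where
  "lap \<sigma> = card {i \<in> {1..length \<sigma> - 1}.
     letter \<sigma> (i - 1) < letter \<sigma> i \<and> letter \<sigma> i = letter \<sigma> (i + 1)}"

definition rpd :: "nat list \<Rightarrow> nat" where
  "rpd \<sigma> = card {i \<in> {2..length \<sigma>}.
     letter \<sigma> (i - 1) = letter \<sigma> i \<and> letter \<sigma> i > letter \<sigma> (i + 1)}"

definition eud :: "nat list \<Rightarrow> nat" where
  "eud \<sigma> = card {i \<in> {1..length \<sigma> - 1}. \<exists>j. i < j \<and> j \<le> length \<sigma> \<and>
     letter \<sigma> (i - 1) < letter \<sigma> i \<and> letter \<sigma> i = letter \<sigma> j \<and> letter \<sigma> j > letter \<sigma> (j + 1)}"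

definition asc :: "nat list \<Rightarrow> nat" where
  "asc \<sigma> = card {i \<in> {0..length \<sigma>}. letter \<sigma> i < letter \<sigma> (i + 1)}"

definition des :: "nat list \<Rightarrow> nat" where
  "des \<sigma> = card {i \<in> {0..length \<sigma>}. letter \<sigma> i > letter \<sigma> (i + 1)}"

definition plat :: "nat list \<Rightarrow> nat" where
  "plat \<sigma> = card {i \<in> {0..length \<sigma>}. letter \<sigma> i = letter \<sigma> (i + 1)}"

definition C_poly :: "nat \<Rightarrow> 'a::comm_ring_1 \<Rightarrow> 'a \<Rightarrow> 'a \<Rightarrow> 'a" where
  "C_poly n x y z = (\<Sum>\<sigma>\<in>stirling_perms n. x ^ asc \<sigma> * y ^ des \<sigma> * z ^ plat \<sigma>)"

definition N_poly :: "nat \<Rightarrow> 'a::comm_ring_1 \<Rightarrow> 'a \<Rightarrow> 'a \<Rightarrow> 'a" where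
  "N_poly n x y z = (\<Sum>\<sigma>\<in>stirling_perms n. x ^ lap \<sigma> * y ^ eud \<sigma> * z ^ rpd \<sigma>)"

definition gamma_indices :: "nat \<Rightarrow> (nat \<times> nat \<times> nat) set" where
  "gamma_indices n = {(i, j, k). i + 2 * j + 3 * k = 2 * n + 1}"

text \<open>
  The integer coefficients of the expansion of \<open>C_poly n\<close> in the elementary symmetric
  polynomials, normalised to vanish off the index set so that they are unique as a
  function. Since the integers are an infinite domain, an identity at all integer points
  is the same as an identity of polynomials.
\<close>

definition gamma_coeffs :: "nat \<Rightarrow> (nat \<Rightarrow> nat \<Rightarrow> nat \<Rightarrow> int) \<Rightarrow> bool" where
  "gamma_coeffs n \<gamma> \<longleftrightarrow>
     (\<forall>i j k. (i, j, k) \<notin> gamma_indices n \<longrightarrow> \<gamma> i j k = 0) \<and>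
     (\<forall>x y z :: int. C_poly n x y z =
        (\<Sum>(i, j, k)\<in>gamma_indices n.
           \<gamma> i j k * (x + y + z) ^ i * (x * y + y * z + z * x) ^ j * (x * y * z) ^ k))"

datatype ptree = Node (label: nat) (children: "ptree list")

primrec labels :: "ptree \<Rightarrow> nat list" where
  "labels (Node a ts) = a # concat (map labels ts)"

text \<open>The list of degrees (numbers of children) of all vertices, in preorder.\<close>

primrec degrees :: "ptree \<Rightarrow> nat list" where
  "degrees (Node a ts) = length ts # concat (map degrees ts)"

inductive increasing :: "ptree \<Rightarrow> bool" where
  "(\<And>t. t \<in> set ts \<Longrightarrow> a < label t \<and> increasing t) \<Longrightarrow> increasing (Node a ts)"

definition increasing_plane_trees :: "nat \<Rightarrow> ptree set" where
  "increasing_plane_trees n =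
    {t. distinct (labels t) \<and> set (labels t) = {1..n} \<and> label t = 1 \<and> increasing t}"

definition trees_0123 :: "nat \<Rightarrow> ptree set" where
  "trees_0123 n = {t \<in> increasing_plane_trees n. \<forall>d \<in> set (degrees t). d \<le> 3}"

definition num_degree :: "nat \<Rightarrow> ptree \<Rightarrow> nat" where
  "num_degree d t = count_list (degrees t) d"

end

theory Submission
  imports Defs "HOL-Computational_Algebra.Polynomial"
begin

text \<open>
  Both expansions are the same identity on ternary trees, read with two different weights.
  A Stirling permutation with least letter \<open>m\<close> factors uniquely as
  \<open>a @ [m] @ b @ [m] @ c\<close>, where no letter occurs in two of \<open>a\<close>, \<open>b\<close>, \<open>c\<close>; iterating
  this turns it into an increasing ternary tree, and \<open>word_bij_betw\<close> says that this is a bijection.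
  Each of the \<open>2 * n + 1\<close> gaps of the zero-padded word belongs to exactly one letter \<open>v\<close>: a gap
  is an ascent into the first copy of \<open>v\<close>, a plateau between its two copies or a descent out of
  the second copy, and these occur exactly when the left, the middle or the right subtree of
  \<open>v\<close> is empty (\<open>prod_word_weight\<close>). So \<open>asc\<close>, \<open>plat\<close>, \<open>des\<close> count the vertices with empty left,
  middle, right slot, while \<open>lap\<close>, \<open>rpd\<close>, \<open>eud\<close> count the vertices with two prescribed
  slots empty.

  Forgetting which slots the children occupy leaves a plane tree with degrees at most three. For
  a weight that is a product over the vertices of a function of the three emptiness bits, the sum
  over all ternary trees with a given underlying plane tree is again a product over the vertices,
  in which a vertex of degree \<open>d\<close> contributes the sum over all ways to choose \<open>d\<close> of the three
  slots (\<open>sum_fibre\<close>). With the weight \<open>x\<close>, \<open>z\<close>, \<open>y\<close> for an empty left, middle, right slot the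
  degrees \<open>0\<close>, \<open>1\<close>, \<open>2\<close>, \<open>3\<close> contribute \<open>x * y * z\<close>, \<open>x * y + y * z + z * x\<close>, \<open>x + y + z\<close> and \<open>1\<close>:
  this is \<open>C_poly\<close>. With \<open>x\<close>, \<open>y\<close>, \<open>z\<close> for an empty pair of slots they contribute
  \<open>x * y * z\<close>, \<open>x + y + z\<close>, \<open>3\<close> and \<open>1\<close>: this is \<open>N_poly\<close>. The numbers of leaves, of vertices of
  degree one and of vertices of degree two satisfy \<open>i + 2 * j + 3 * k = 2 * n + 1\<close> because a tree on
  \<open>n\<close> vertices has \<open>n - 1\<close> edges.

  It remains that the coefficients \<open>\<gamma>\<close> are determined by \<open>C_poly\<close>. This is the algebraic
  independence of the elementary symmetric polynomials, made elementary in
  \<open>elementary_symmetric_independent\<close> by substituting powers of a single variable.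
\<close>

section \<open>Gaps of a Stirling permutation and the letters they belong to\<close>

text \<open>
  Recording gaps by their letter instead of their position makes the statistics insensitive to
  the place of a factor inside a longer word, so that they can be computed along the
  decomposition at the least letter.
\<close>

definition adjacent :: "nat list \<Rightarrow> (nat \<times> nat) set" where
  "adjacent xs = set (zip xs (tl xs))"

definition rises :: "nat list \<Rightarrow> nat set" where
  "rises xs = {v. \<exists>u<v. (u, v) \<in> adjacent xs}"

definition plateaux :: "nat list \<Rightarrow> nat set" where
  "plateaux xs = {v. (v, v) \<in> adjacent xs}"

definition drops :: "nat list \<Rightarrow> nat set" where
  "drops xs = {v. \<exists>u<v. (v, u) \<in> adjacent xs}"

abbreviation pad :: "nat list \<Rightarrow> nat list" where
  "pad \<sigma> \<equiv> 0 # \<sigma> @ [0]"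

lemma letter_0 [simp]: "letter \<sigma> 0 = 0"
  by (simp add: letter_def)

lemma letter_Suc: "i < length \<sigma> \<Longrightarrow> letter \<sigma> (Suc i) = \<sigma> ! i"
  by (simp add: letter_def nth_append)

lemma letter_Suc_length [simp]: "letter \<sigma> (Suc (length \<sigma>)) = 0"
  by (simp add: letter_def nth_append)

lemma adjacent_pad:
  "(u, v) \<in> adjacent (pad \<sigma>) \<longleftrightarrow> (\<exists>i\<le>length \<sigma>. letter \<sigma> i = u \<and> letter \<sigma> (i + 1) = v)"
  by (auto simp: adjacent_def set_zip letter_def less_Suc_eq_le)

lemma stirling_perms_count:
  assumes "\<sigma> \<in> stirling_perms n"
  shows "count_list \<sigma> v = (if 1 \<le> v \<and> v \<le> n then 2 else 0)"
proof -
  have "mset \<sigma> = mset_set {1..n} + mset_set {1..n}"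
    using assms by (simp add: stirling_perms_def)
  then have "count (mset \<sigma>) v = count (mset_set {1..n} + mset_set {1..n}) v" by simp
  then show ?thesis by (simp add: count_mset count_mset_set')
qed

lemma set_stirling_perms:
  assumes "\<sigma> \<in> stirling_perms n"
  shows "set \<sigma> = {1..n}"
proof -
  have "v \<in> set \<sigma> \<longleftrightarrow> v \<in> {1..n}" for v
    using stirling_perms_count[OF assms, of v] count_list_0_iff[of \<sigma> v]
    by (auto split: if_splits)
  then show ?thesis by blast
qed

lemma stirling_perms_letter_range:
  assumes "\<sigma> \<in> stirling_perms n" "1 \<le> i" "i \<le> length \<sigma>"
  shows "letter \<sigma> i \<in> {1..n}"
proof -
  obtain k where k: "i = Suc k" "k < length \<sigma>"
    using assms by (cases i) auto
  then have "letter \<sigma> i \<in> set \<sigma>" by (simp add: letter_Suc)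
  then show ?thesis using set_stirling_perms[OF assms(1)] by simp
qed

lemma stirling_perms_between:
  assumes "\<sigma> \<in> stirling_perms n" "letter \<sigma> i = letter \<sigma> j"
    "1 \<le> i" "i \<le> s" "s \<le> j" "j \<le> length \<sigma>"
  shows "letter \<sigma> i \<le> letter \<sigma> s"
proof (cases "i = s \<or> s = j")
  case True
  then show ?thesis using assms(2) by auto
next
  case False
  then have "i < s" "s < j" using assms by auto
  then show ?thesis
    using assms(1,2,3,6) unfolding stirling_perms_def by blast
qed

lemma stirling_perms_card_positions:
  assumes "\<sigma> \<in> stirling_perms n" "v \<in> {1..n}"
  shows "card {i \<in> {1..length \<sigma>}. letter \<sigma> i = v} = 2"
proof -
  have eq: "{i \<in> {1..length \<sigma>}. letter \<sigma> i = v} = Suc ` {i. i < length \<sigma> \<and> v = \<sigma> ! i}"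
  proof (intro equalityI subsetI)
    fix i assume "i \<in> {i \<in> {1..length \<sigma>}. letter \<sigma> i = v}"
    then show "i \<in> Suc ` {i. i < length \<sigma> \<and> v = \<sigma> ! i}"
      by (cases i) (auto simp: letter_Suc)
  qed (auto simp: letter_Suc)
  have "card {i. i < length \<sigma> \<and> v = \<sigma> ! i} = 2"
    using stirling_perms_count[OF assms(1), of v] assms(2)
    by (simp add: count_list_eq_length_filter length_filter_conv_card)
  then show ?thesis unfolding eq by (simp add: card_image)
qed

lemma stirling_perms_no_third_copy:
  assumes "\<sigma> \<in> stirling_perms n" "1 \<le> i" "i \<le> length \<sigma>" "1 \<le> j" "j \<le> length \<sigma>"
    "1 \<le> k" "k \<le> length \<sigma>" "letter \<sigma> i = letter \<sigma> j" "letter \<sigma> i = letter \<sigma> k"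
  shows "i = j \<or> i = k \<or> j = k"
proof (rule ccontr)
  assume "\<not> ?thesis"
  then have "card {i, j, k} = 3" by auto
  moreover have "{i, j, k} \<subseteq> {l \<in> {1..length \<sigma>}. letter \<sigma> l = letter \<sigma> i}"
    using assms by auto
  then have "card {i, j, k} \<le> card {l \<in> {1..length \<sigma>}. letter \<sigma> l = letter \<sigma> i}"
    by (rule card_mono[rotated]) simp
  ultimately show False
    using stirling_perms_card_positions[OF assms(1) stirling_perms_letter_range[OF assms(1-3)]] by simp
qed

lemma stirling_perms_second_copy:
  assumes "\<sigma> \<in> stirling_perms n" "1 \<le> i" "i \<le> length \<sigma>"
  obtains j where "1 \<le> j" "j \<le> length \<sigma>" "j \<noteq> i" "letter \<sigma> j = letter \<sigma> i"
proof -
  have "\<not> {l \<in> {1..length \<sigma>}. letter \<sigma> l = letter \<sigma> i} \<subseteq> {i}"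
    using stirling_perms_card_positions[OF assms(1) stirling_perms_letter_range[OF assms]]
      card_mono[of "{i}" "{l \<in> {1..length \<sigma>}. letter \<sigma> l = letter \<sigma> i}"] by auto
  then show ?thesis using that by auto
qed

text \<open>
  An ascent can only lead into the first copy of a letter: before the second copy the word stays
  at or above that letter. Dually, a descent can only leave the second copy.
\<close>

lemma stirling_perms_rise_unique:
  assumes "\<sigma> \<in> stirling_perms n" "1 \<le> i" "i \<le> length \<sigma>" "1 \<le> j" "j \<le> length \<sigma>"
    "letter \<sigma> i = letter \<sigma> j" "letter \<sigma> (i - 1) < letter \<sigma> i"
  shows "i \<le> j"
proof (rule ccontr)
  assume "\<not> i \<le> j"
  then have "j \<le> i - 1" by simp
  then have "letter \<sigma> j \<le> letter \<sigma> (i - 1)"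
    using stirling_perms_between[OF assms(1), of j i "i - 1"] assms by auto
  then show False using assms by simp
qed

lemma stirling_perms_drop_unique:
  assumes "\<sigma> \<in> stirling_perms n" "1 \<le> i" "i \<le> length \<sigma>" "1 \<le> j" "j \<le> length \<sigma>"
    "letter \<sigma> i = letter \<sigma> j" "letter \<sigma> (i + 1) < letter \<sigma> i"
  shows "j \<le> i"
proof (rule ccontr)
  assume "\<not> j \<le> i"
  then have "letter \<sigma> i \<le> letter \<sigma> (i + 1)"
    using stirling_perms_between[OF assms(1), of i j "i + 1"] assms by auto
  then show False using assms by simp
qed

lemma stirling_perms_inj_on_rises:
  assumes "\<sigma> \<in> stirling_perms n"
  shows "inj_on (letter \<sigma>) {i \<in> {1..length \<sigma>}. letter \<sigma> (i - 1) < letter \<sigma> i}"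
proof (rule inj_onI)
  fix i j assume ij: "i \<in> {i \<in> {1..length \<sigma>}. letter \<sigma> (i - 1) < letter \<sigma> i}"
    "j \<in> {i \<in> {1..length \<sigma>}. letter \<sigma> (i - 1) < letter \<sigma> i}" "letter \<sigma> i = letter \<sigma> j"
  have "i \<le> j" by (rule stirling_perms_rise_unique[OF assms]) (use ij in simp_all)
  moreover have "j \<le> i" by (rule stirling_perms_rise_unique[OF assms]) (use ij in simp_all)
  ultimately show "i = j" by simp
qed

lemma stirling_perms_inj_on_drops:
  assumes "\<sigma> \<in> stirling_perms n"
  shows "inj_on (letter \<sigma>) {i \<in> {1..length \<sigma>}. letter \<sigma> (i + 1) < letter \<sigma> i}"
proof (rule inj_onI)
  fix i j assume ij: "i \<in> {i \<in> {1..length \<sigma>}. letter \<sigma> (i + 1) < letter \<sigma> i}"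
    "j \<in> {i \<in> {1..length \<sigma>}. letter \<sigma> (i + 1) < letter \<sigma> i}" "letter \<sigma> i = letter \<sigma> j"
  have "i \<le> j" by (rule stirling_perms_drop_unique[OF assms]) (use ij in simp_all)
  moreover have "j \<le> i" by (rule stirling_perms_drop_unique[OF assms]) (use ij in simp_all)
  ultimately show "i = j" by simp
qed

lemma rises_pad:
  "v \<in> rises (pad \<sigma>) \<longleftrightarrow> (\<exists>i\<in>{1..length \<sigma>}. letter \<sigma> (i - 1) < letter \<sigma> i \<and> letter \<sigma> i = v)"
proof
  assume "v \<in> rises (pad \<sigma>)"
  then obtain i where i: "i \<le> length \<sigma>" "letter \<sigma> i < letter \<sigma> (i + 1)" "letter \<sigma> (i + 1) = v"
    by (auto simp: rises_def adjacent_pad)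
  then have "i \<noteq> length \<sigma>" by (metis Suc_eq_plus1 letter_Suc_length not_less_zero)
  then show "\<exists>i\<in>{1..length \<sigma>}. letter \<sigma> (i - 1) < letter \<sigma> i \<and> letter \<sigma> i = v"
    using i by (intro bexI[of _ "i + 1"]) auto
next
  assume "\<exists>i\<in>{1..length \<sigma>}. letter \<sigma> (i - 1) < letter \<sigma> i \<and> letter \<sigma> i = v"
  then obtain i where i: "i\<in>{1..length \<sigma>}" "letter \<sigma> (i - 1) < letter \<sigma> i" "letter \<sigma> i = v" by blast
  then have "i - 1 \<le> length \<sigma> \<and> letter \<sigma> (i - 1) = letter \<sigma> (i - 1) \<and> letter \<sigma> (i - 1 + 1) = v" by auto
  then have "(letter \<sigma> (i - 1), v) \<in> adjacent (pad \<sigma>)" unfolding adjacent_pad by blast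
  then show "v \<in> rises (pad \<sigma>)" using i unfolding rises_def by blast
qed

lemma drops_pad:
  "v \<in> drops (pad \<sigma>) \<longleftrightarrow> (\<exists>i\<in>{1..length \<sigma>}. letter \<sigma> (i + 1) < letter \<sigma> i \<and> letter \<sigma> i = v)"
proof
  assume "v \<in> drops (pad \<sigma>)"
  then obtain i where i: "i \<le> length \<sigma>" "letter \<sigma> (i + 1) < letter \<sigma> i" "letter \<sigma> i = v"
    by (auto simp: drops_def adjacent_pad)
  then have "i \<noteq> 0" by (metis letter_0 not_less_zero)
  then show "\<exists>i\<in>{1..length \<sigma>}. letter \<sigma> (i + 1) < letter \<sigma> i \<and> letter \<sigma> i = v"
    using i by auto
next
  assume "\<exists>i\<in>{1..length \<sigma>}. letter \<sigma> (i + 1) < letter \<sigma> i \<and> letter \<sigma> i = v"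
  then obtain i where i: "i \<le> length \<sigma>" "letter \<sigma> (i + 1) < letter \<sigma> i" "letter \<sigma> i = v" by auto
  then have "(v, letter \<sigma> (i + 1)) \<in> adjacent (pad \<sigma>)" unfolding adjacent_pad by blast
  then show "v \<in> drops (pad \<sigma>)" using i unfolding drops_def by blast
qed

text \<open>
  Without \<open>n \<ge> 1\<close> the two padding zeros would be neighbours and form a plateau of their own.
\<close>

lemma plateaux_pad:
  assumes "\<sigma> \<in> stirling_perms n" "n \<ge> 1"
  shows "v \<in> plateaux (pad \<sigma>) \<longleftrightarrow>
    (\<exists>i\<in>{1..length \<sigma> - 1}. letter \<sigma> i = v \<and> letter \<sigma> (i + 1) = v)"
proof
  assume "v \<in> plateaux (pad \<sigma>)"
  then obtain i where i: "i \<le> length \<sigma>" "letter \<sigma> i = v" "letter \<sigma> (i + 1) = v"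
    by (auto simp: plateaux_def adjacent_pad)
  have "\<sigma> \<noteq> []" using set_stirling_perms[OF assms(1)] assms(2) by auto
  then have pos: "letter \<sigma> 1 > 0" "letter \<sigma> (length \<sigma>) > 0"
    using stirling_perms_letter_range[OF assms(1), of 1]
      stirling_perms_letter_range[OF assms(1), of "length \<sigma>"]
    by (cases \<sigma>; force)+
  then have "i \<noteq> 0" "i \<noteq> length \<sigma>"
    using i by (auto intro!: Nat.gr0I)
  then show "\<exists>i\<in>{1..length \<sigma> - 1}. letter \<sigma> i = v \<and> letter \<sigma> (i + 1) = v"
    using i by (intro bexI[of _ i]) auto
next
  assume "\<exists>i\<in>{1..length \<sigma> - 1}. letter \<sigma> i = v \<and> letter \<sigma> (i + 1) = v"
  then obtain i where "i \<in> {1..length \<sigma> - 1}" "letter \<sigma> i = v" "letter \<sigma> (i + 1) = v" by blast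
  moreover from this have "i \<le> length \<sigma>" by (metis atLeastAtMost_iff diff_le_self le_trans)
  ultimately show "v \<in> plateaux (pad \<sigma>)" unfolding plateaux_def mem_Collect_eq adjacent_pad by blast
qed

lemma rises_pad_image:
  "rises (pad \<sigma>) = letter \<sigma> ` {i \<in> {1..length \<sigma>}. letter \<sigma> (i - 1) < letter \<sigma> i}"
  unfolding set_eq_iff rises_pad by blast

lemma drops_pad_image:
  "drops (pad \<sigma>) = letter \<sigma> ` {i \<in> {1..length \<sigma>}. letter \<sigma> (i + 1) < letter \<sigma> i}"
  unfolding set_eq_iff drops_pad by blast

text \<open>
  The six statistics count positions; each counted position is determined by its letter, because
  a letter has one ascent into it, one descent out of it and at most one plateau. For the
  statistics that combine two conditions, the two positions found for the same letter have to be
  matched, which uses that a letter has exactly two copies.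
\<close>

lemma asc_eq_card:
  assumes "\<sigma> \<in> stirling_perms n"
  shows "asc \<sigma> = card (rises (pad \<sigma>))"
proof -
  let ?I = "{i \<in> {0..length \<sigma>}. letter \<sigma> i < letter \<sigma> (i + 1)}"
  let ?J = "{i \<in> {1..length \<sigma>}. letter \<sigma> (i - 1) < letter \<sigma> i}"
  have "Suc ` ?I = ?J"
  proof (intro equalityI subsetI)
    fix j assume "j \<in> Suc ` ?I"
    then obtain i where i: "j = Suc i" "i \<le> length \<sigma>" "letter \<sigma> i < letter \<sigma> (Suc i)" by auto
    then have "i \<noteq> length \<sigma>" by auto
    then show "j \<in> ?J" using i by simp
  next
    fix j assume "j \<in> ?J"
    then show "j \<in> Suc ` ?I" by (intro image_eqI[of _ _ "j - 1"]) auto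
  qed
  then have "card ?I = card ?J" using card_image[of Suc ?I] by (simp only: inj_Suc)
  then show ?thesis
    unfolding asc_def rises_pad_image card_image[OF stirling_perms_inj_on_rises[OF assms]] .
qed

lemma des_eq_card:
  assumes "\<sigma> \<in> stirling_perms n"
  shows "des \<sigma> = card (drops (pad \<sigma>))"
proof -
  have "{i \<in> {0..length \<sigma>}. letter \<sigma> i > letter \<sigma> (i + 1)} =
      {i \<in> {1..length \<sigma>}. letter \<sigma> (i + 1) < letter \<sigma> i}" (is "?I = ?J")
  proof (intro equalityI subsetI)
    fix i assume i: "i \<in> ?I"
    then have "i \<noteq> 0" by (intro notI) simp
    then show "i \<in> ?J" using i by simp
  qed simp
  then show ?thesis
    unfolding des_def drops_pad_image card_image[OF stirling_perms_inj_on_drops[OF assms]]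
    by (rule arg_cong[of _ _ card])
qed

lemma plateaux_pad_image:
  assumes "\<sigma> \<in> stirling_perms n" "n \<ge> 1"
  shows "plateaux (pad \<sigma>) = letter \<sigma> ` {i \<in> {1..length \<sigma> - 1}. letter \<sigma> i = letter \<sigma> (i + 1)}"
proof (intro equalityI subsetI)
  fix v assume "v \<in> plateaux (pad \<sigma>)"
  then obtain i where "i \<in> {1..length \<sigma> - 1}" "letter \<sigma> i = v" "letter \<sigma> (i + 1) = v"
    unfolding plateaux_pad[OF assms] by blast
  then show "v \<in> letter \<sigma> ` {i \<in> {1..length \<sigma> - 1}. letter \<sigma> i = letter \<sigma> (i + 1)}"
    by (intro image_eqI[of _ _ i]) simp_all
next
  fix v assume "v \<in> letter \<sigma> ` {i \<in> {1..length \<sigma> - 1}. letter \<sigma> i = letter \<sigma> (i + 1)}"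
  then obtain i where i: "i \<in> {1..length \<sigma> - 1}" "letter \<sigma> i = letter \<sigma> (i + 1)" "v = letter \<sigma> i"
    by blast
  then have "letter \<sigma> i = v" "letter \<sigma> (i + 1) = v" by (simp_all only:)
  then show "v \<in> plateaux (pad \<sigma>)"
    unfolding plateaux_pad[OF assms] using i(1) by blast
qed

lemma plat_eq_card:
  assumes "\<sigma> \<in> stirling_perms n" "n \<ge> 1"
  shows "plat \<sigma> = card (plateaux (pad \<sigma>))"
proof -
  let ?I = "{i \<in> {0..length \<sigma>}. letter \<sigma> i = letter \<sigma> (i + 1)}"
  let ?J = "{i \<in> {1..length \<sigma> - 1}. letter \<sigma> i = letter \<sigma> (i + 1)}"
  have "\<sigma> \<noteq> []" using set_stirling_perms[OF assms(1)] assms(2) by auto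
  then have pos: "letter \<sigma> 1 > 0" "letter \<sigma> (length \<sigma>) > 0"
    using stirling_perms_letter_range[OF assms(1), of 1]
      stirling_perms_letter_range[OF assms(1), of "length \<sigma>"]
    by (cases \<sigma>; force)+
  have "?I \<subseteq> ?J"
  proof
    fix i assume i: "i \<in> ?I"
    then have "i \<noteq> 0" "i \<noteq> length \<sigma>" using pos by (auto intro!: Nat.gr0I)
    then show "i \<in> ?J" using i by auto
  qed
  then have IJ: "?I = ?J" by auto
  have "inj_on (letter \<sigma>) ?J"
  proof (rule inj_onI)
    fix i j assume ij: "i \<in> ?J" "j \<in> ?J" "letter \<sigma> i = letter \<sigma> j"
    have adj: "l \<noteq> m \<Longrightarrow> m = l + 1" if "l \<in> ?J" "m \<in> ?J" "letter \<sigma> l = letter \<sigma> m" for l m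
    proof -
      have "1 \<le> l" "l + 1 \<le> length \<sigma>" "1 \<le> m" "m \<le> length \<sigma>"
        "letter \<sigma> l = letter \<sigma> (l + 1)" using that by auto
      then show "l \<noteq> m \<Longrightarrow> m = l + 1"
        using stirling_perms_no_third_copy[OF assms(1), of l "l + 1" m] that(3) by linarith
    qed
    have "i \<noteq> j \<Longrightarrow> j = i + 1" "j \<noteq> i \<Longrightarrow> i = j + 1"
      using adj[OF ij] adj[OF ij(2,1) ij(3)[symmetric]] by blast+
    then show "i = j" by linarith
  qed
  then show ?thesis
    unfolding plat_def IJ plateaux_pad_image[OF assms] by (simp only: card_image)
qed

lemma lap_eq_card:
  assumes "\<sigma> \<in> stirling_perms n" "n \<ge> 1"
  shows "lap \<sigma> = card (rises (pad \<sigma>) \<inter> plateaux (pad \<sigma>))"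
proof -
  let ?I = "{i \<in> {1..length \<sigma> - 1}. letter \<sigma> (i - 1) < letter \<sigma> i \<and> letter \<sigma> i = letter \<sigma> (i + 1)}"
  have "?I \<subseteq> {i \<in> {1..length \<sigma>}. letter \<sigma> (i - 1) < letter \<sigma> i}"
    by (rule subsetI) (unfold mem_Collect_eq atLeastAtMost_iff, linarith)
  from inj_on_subset[OF stirling_perms_inj_on_rises[OF assms(1)] this]
  have inj: "inj_on (letter \<sigma>) ?I" .
  have img: "letter \<sigma> ` ?I = rises (pad \<sigma>) \<inter> plateaux (pad \<sigma>)"
  proof (intro equalityI subsetI)
    fix v assume "v \<in> letter \<sigma> ` ?I"
    then obtain i where i: "1 \<le> i" "i \<le> length \<sigma> - 1" "letter \<sigma> (i - 1) < letter \<sigma> i"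
      "letter \<sigma> i = letter \<sigma> (i + 1)" "v = letter \<sigma> i"
      unfolding image_iff mem_Collect_eq bex_simps atLeastAtMost_iff by blast
    from i(1,2) have "i \<in> {1..length \<sigma> - 1}" "i \<in> {1..length \<sigma>}"
      unfolding atLeastAtMost_iff by linarith+
    with i show "v \<in> rises (pad \<sigma>) \<inter> plateaux (pad \<sigma>)"
      unfolding rises_pad_image plateaux_pad_image[OF assms]
      by (intro IntI image_eqI[of _ _ i] CollectI conjI)
  next
    fix v assume "v \<in> rises (pad \<sigma>) \<inter> plateaux (pad \<sigma>)"
    then obtain i j where i: "1 \<le> i" "i \<le> length \<sigma>" "letter \<sigma> (i - 1) < letter \<sigma> i" "letter \<sigma> i = v"
      and j: "1 \<le> j" "j \<le> length \<sigma> - 1" "letter \<sigma> j = v" "letter \<sigma> (j + 1) = v"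
      unfolding Int_iff plateaux_pad[OF assms] rises_pad Bex_def atLeastAtMost_iff by blast
    (* The ascent leads into one of the two adjacent copies, necessarily into the first. *)
    have "i = j \<or> i = j + 1"
      using stirling_perms_no_third_copy[OF assms(1), of i j "j + 1"] i j by linarith
    moreover have "i \<noteq> j + 1" using i j by auto
    ultimately have "i = j" by simp
    then have "i \<in> ?I" using i j by simp
    then show "v \<in> letter \<sigma> ` ?I" using i(4) by blast
  qed
  show ?thesis unfolding lap_def img[symmetric] by (rule card_image[OF inj, symmetric])
qed

lemma rpd_eq_card:
  assumes "\<sigma> \<in> stirling_perms n" "n \<ge> 1"
  shows "rpd \<sigma> = card (plateaux (pad \<sigma>) \<inter> drops (pad \<sigma>))"
proof -
  let ?I = "{i \<in> {2..length \<sigma>}. letter \<sigma> (i - 1) = letter \<sigma> i \<and> letter \<sigma> i > letter \<sigma> (i + 1)}"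
  have "?I \<subseteq> {i \<in> {1..length \<sigma>}. letter \<sigma> (i + 1) < letter \<sigma> i}"
    by (rule subsetI) (unfold mem_Collect_eq atLeastAtMost_iff, linarith)
  from inj_on_subset[OF stirling_perms_inj_on_drops[OF assms(1)] this]
  have inj: "inj_on (letter \<sigma>) ?I" .
  have img: "letter \<sigma> ` ?I = plateaux (pad \<sigma>) \<inter> drops (pad \<sigma>)"
  proof (intro equalityI subsetI)
    fix v assume "v \<in> letter \<sigma> ` ?I"
    then obtain i where i: "2 \<le> i" "i \<le> length \<sigma>" "letter \<sigma> (i - 1) = letter \<sigma> i"
      "letter \<sigma> (i + 1) < letter \<sigma> i" "v = letter \<sigma> i"
      unfolding image_iff mem_Collect_eq bex_simps atLeastAtMost_iff by blast
    from i(1,2) have r: "i - 1 \<in> {1..length \<sigma> - 1}" "i \<in> {1..length \<sigma>}" and "i - 1 + 1 = i"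
      unfolding atLeastAtMost_iff by linarith+
    then have "letter \<sigma> (i - 1) = v" "letter \<sigma> (i - 1 + 1) = v"
      using i(3,5) by (simp_all only:)
    with r i have "v \<in> plateaux (pad \<sigma>)"
      unfolding plateaux_pad[OF assms] by (intro bexI[of _ "i - 1"] conjI)
    moreover have "v \<in> drops (pad \<sigma>)"
      unfolding drops_pad_image using r i by (intro image_eqI[of _ _ i] CollectI conjI)
    ultimately show "v \<in> plateaux (pad \<sigma>) \<inter> drops (pad \<sigma>)" by (rule IntI)
  next
    fix v assume "v \<in> plateaux (pad \<sigma>) \<inter> drops (pad \<sigma>)"
    then obtain i j where i: "1 \<le> i" "i \<le> length \<sigma>" "letter \<sigma> (i + 1) < letter \<sigma> i" "letter \<sigma> i = v"
      and j: "1 \<le> j" "j \<le> length \<sigma> - 1" "letter \<sigma> j = v" "letter \<sigma> (j + 1) = v"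
      unfolding Int_iff plateaux_pad[OF assms] drops_pad Bex_def atLeastAtMost_iff by blast
    have "i = j \<or> i = j + 1"
      using stirling_perms_no_third_copy[OF assms(1), of i j "j + 1"] i j by linarith
    moreover have "i \<noteq> j" using i j by auto
    ultimately have "i = j + 1" by simp
    then have "i \<in> ?I" using i j by simp
    then show "v \<in> letter \<sigma> ` ?I" using i(4) by blast
  qed
  show ?thesis unfolding rpd_def img[symmetric] by (rule card_image[OF inj, symmetric])
qed

lemma eud_eq_card:
  assumes "\<sigma> \<in> stirling_perms n"
  shows "eud \<sigma> = card (rises (pad \<sigma>) \<inter> drops (pad \<sigma>))"
proof -
  let ?I = "{i \<in> {1..length \<sigma> - 1}. \<exists>j. i < j \<and> j \<le> length \<sigma> \<and>
     letter \<sigma> (i - 1) < letter \<sigma> i \<and> letter \<sigma> i = letter \<sigma> j \<and> letter \<sigma> j > letter \<sigma> (j + 1)}"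
  have "?I \<subseteq> {i \<in> {1..length \<sigma>}. letter \<sigma> (i - 1) < letter \<sigma> i}"
    by (rule subsetI) (unfold mem_Collect_eq atLeastAtMost_iff, elim conjE exE, linarith)
  from inj_on_subset[OF stirling_perms_inj_on_rises[OF assms(1)] this]
  have inj: "inj_on (letter \<sigma>) ?I" .
  have img: "letter \<sigma> ` ?I = rises (pad \<sigma>) \<inter> drops (pad \<sigma>)"
  proof (intro equalityI subsetI)
    fix v assume "v \<in> letter \<sigma> ` ?I"
    then obtain i j where ij: "1 \<le> i" "v = letter \<sigma> i" "i < j" "j \<le> length \<sigma>"
      "letter \<sigma> (i - 1) < letter \<sigma> i" "letter \<sigma> i = letter \<sigma> j" "letter \<sigma> j > letter \<sigma> (j + 1)"
      unfolding image_iff mem_Collect_eq bex_simps atLeastAtMost_iff by blast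
    from ij(1,3,4) have "i \<in> {1..length \<sigma>}" "j \<in> {1..length \<sigma>}"
      unfolding atLeastAtMost_iff by linarith+
    moreover have "v = letter \<sigma> j" using ij by simp
    ultimately have ji: "i \<in> {1..length \<sigma>}" "j \<in> {1..length \<sigma>}" "v = letter \<sigma> j" .
    have "v \<in> rises (pad \<sigma>)"
      unfolding rises_pad_image using ij ji by (intro image_eqI[of _ _ i] CollectI conjI)
    moreover have "v \<in> drops (pad \<sigma>)"
      unfolding drops_pad_image using ij ji by (intro image_eqI[of _ _ j] CollectI conjI)
    ultimately show "v \<in> rises (pad \<sigma>) \<inter> drops (pad \<sigma>)" by (rule IntI)
  next
    fix v assume "v \<in> rises (pad \<sigma>) \<inter> drops (pad \<sigma>)"
    then obtain i j where i: "1 \<le> i" "i \<le> length \<sigma>" "letter \<sigma> (i - 1) < letter \<sigma> i" "letter \<sigma> i = v"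
      and j: "1 \<le> j" "j \<le> length \<sigma>" "letter \<sigma> (j + 1) < letter \<sigma> j" "letter \<sigma> j = v"
      unfolding Int_iff rises_pad drops_pad Bex_def atLeastAtMost_iff by blast
    (* The other copy at k lies after the ascent and before the descent, so i and j differ. *)
    obtain k where k: "1 \<le> k" "k \<le> length \<sigma>" "k \<noteq> i" "letter \<sigma> k = letter \<sigma> i"
      using stirling_perms_second_copy[OF assms i(1,2)] .
    have "i \<le> k" "k \<le> j"
      using stirling_perms_rise_unique[OF assms i(1,2) k(1,2) k(4)[symmetric] i(3)]
        stirling_perms_drop_unique[OF assms j(1,2) k(1,2) _ j(3)] i(4) j(4) k(4) by simp_all
    then have "i < j" using k(3) by simp
    moreover have "letter \<sigma> i = letter \<sigma> j" using i j by simp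
    moreover have "i \<in> {1..length \<sigma> - 1}"
      unfolding atLeastAtMost_iff using i(1) j(2) \<open>i < j\<close> by linarith
    ultimately have "i \<in> ?I" using i(3) j(2,3) by blast
    then show "v \<in> letter \<sigma> ` ?I" using i(4) by blast
  qed
  show ?thesis unfolding eud_def img[symmetric] by (rule card_image[OF inj, symmetric])
qed

section \<open>Stirling permutations as increasing ternary trees\<close>

datatype ternary = Tip | Tern nat ternary ternary ternary

primrec preorder :: "ternary \<Rightarrow> nat list" where
  "preorder Tip = []"
| "preorder (Tern m a b c) = m # preorder a @ preorder b @ preorder c"

primrec word :: "ternary \<Rightarrow> nat list" where
  "word Tip = []"
| "word (Tern m a b c) = word a @ m # word b @ m # word c"

primrec heap_ordered :: "ternary \<Rightarrow> bool" where
  "heap_ordered Tip \<longleftrightarrow> True"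
| "heap_ordered (Tern m a b c) \<longleftrightarrow>
     (\<forall>v \<in> set (preorder a @ preorder b @ preorder c). m < v) \<and>
     heap_ordered a \<and> heap_ordered b \<and> heap_ordered c"

text \<open>
  The arguments of \<open>f\<close> tell whether the left, the middle and the right slot of the vertex are
  empty.
\<close>

primrec tree_weight :: "(bool \<Rightarrow> bool \<Rightarrow> bool \<Rightarrow> 'a::comm_ring_1) \<Rightarrow> ternary \<Rightarrow> 'a" where
  "tree_weight f Tip = 1"
| "tree_weight f (Tern m a b c) =
     f (a = Tip) (b = Tip) (c = Tip) * (tree_weight f a * (tree_weight f b * tree_weight f c))"

definition ternary_trees :: "nat \<Rightarrow> ternary set" where
  "ternary_trees n = {t. heap_ordered t \<and> distinct (preorder t) \<and> set (preorder t) = {1..n}}"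

text \<open>
  The defining condition of Stirling permutations in terms of list positions. It is inherited by
  factors and can be rebuilt from them, which the bijection with trees needs in both directions.
\<close>

definition nested :: "nat list \<Rightarrow> bool" where
  "nested w \<longleftrightarrow> (\<forall>i s j. i < s \<and> s < j \<and> j < length w \<and> w ! i = w ! j \<longrightarrow> w ! i \<le> w ! s)"

lemma set_word [simp]: "set (word t) = set (preorder t)"
  by (induction t) auto

lemma word_eq_Nil [simp]: "word t = [] \<longleftrightarrow> t = Tip"
  by (cases t) auto

lemma count_list_word: "count_list (word t) v = 2 * count_list (preorder t) v"
  by (induction t) auto

lemma stirling_perms_iff:
  "\<sigma> \<in> stirling_perms n \<longleftrightarrow>
     (\<forall>v. count_list \<sigma> v = (if v \<in> {1..n} then 2 else 0)) \<and> nested \<sigma>"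
proof -
  have "count (mset_set {1..n} + mset_set {1..n}) v = (if v \<in> {1..n} then 2 else 0)" for v
    by (simp add: count_mset_set')
  then have "mset \<sigma> = mset_set {1..n} + mset_set {1..n} \<longleftrightarrow>
      (\<forall>v. count_list \<sigma> v = (if v \<in> {1..n} then 2 else 0))"
    unfolding multiset_eq_iff count_mset by simp
  moreover have "(\<forall>i s j. 1 \<le> i \<and> i < s \<and> s < j \<and> j \<le> length \<sigma> \<and> letter \<sigma> i = letter \<sigma> j
            \<longrightarrow> letter \<sigma> s \<ge> letter \<sigma> i) \<longleftrightarrow> nested \<sigma>" (is "?L \<longleftrightarrow> _")
  proof
    assume L: ?L
    show "nested \<sigma>"
      unfolding nested_def
    proof (intro allI impI, elim conjE)
      fix i s j assume h: "i < s" "s < j" "j < length \<sigma>" "\<sigma> ! i = \<sigma> ! j"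
      then have l: "letter \<sigma> (Suc i) = \<sigma> ! i" "letter \<sigma> (Suc s) = \<sigma> ! s" "letter \<sigma> (Suc j) = \<sigma> ! j"
        by (simp_all add: letter_Suc)
      show "\<sigma> ! i \<le> \<sigma> ! s"
        using L[rule_format, of "Suc i" "Suc s" "Suc j"] h unfolding l by linarith
    qed
  next
    assume N: "nested \<sigma>"
    show ?L
    proof (intro allI impI, elim conjE)
      fix i s j assume h: "1 \<le> i" "i < s" "s < j" "j \<le> length \<sigma>" "letter \<sigma> i = letter \<sigma> j"
      define i' s' j' where d: "i' = i - 1" "s' = s - 1" "j' = j - 1"
      have e: "i = Suc i'" "s = Suc s'" "j = Suc j'" using h unfolding d by linarith+
      have b: "i' < s'" "s' < j'" "j' < length \<sigma>" using h unfolding e by linarith+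
      then have l: "letter \<sigma> i = \<sigma> ! i'" "letter \<sigma> s = \<sigma> ! s'" "letter \<sigma> j = \<sigma> ! j'"
        unfolding e by (simp_all add: letter_Suc)
      show "letter \<sigma> i \<le> letter \<sigma> s" 
        using N[unfolded nested_def, rule_format, of i' s' j'] b h(5) unfolding l by blast
    qed
  qed
  ultimately show ?thesis unfolding stirling_perms_def by simp
qed

lemma nested_appendD1: "nested (u @ v) \<Longrightarrow> nested u"
  unfolding nested_def
proof (intro allI impI, elim conjE)
  fix i s j assume h: "i < s" "s < j" "j < length u" "u ! i = u ! j"
    and N: "\<forall>i s j. i < s \<and> s < j \<and> j < length (u @ v) \<and> (u @ v) ! i = (u @ v) ! j \<longrightarrow> (u @ v) ! i \<le> (u @ v) ! s"
  show "u ! i \<le> u ! s"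
    using N[rule_format, of i s j] h by (simp add: nth_append)
qed

lemma nested_appendD2: "nested (u @ v) \<Longrightarrow> nested v"
  unfolding nested_def
proof (intro allI impI, elim conjE)
  fix i s j assume h: "i < s" "s < j" "j < length v" "v ! i = v ! j"
    and N: "\<forall>i s j. i < s \<and> s < j \<and> j < length (u @ v) \<and> (u @ v) ! i = (u @ v) ! j \<longrightarrow> (u @ v) ! i \<le> (u @ v) ! s"
  show "v ! i \<le> v ! s"
    using N[rule_format, of "length u + i" "length u + s" "length u + j"] h by (simp add: nth_append)
qed

lemma nested_append:
  assumes "nested u" "nested v" "set u \<inter> set v = {}"
  shows "nested (u @ v)"
  unfolding nested_def
proof (intro allI impI, elim conjE)
  fix i s j assume h: "i < s" "s < j" "j < length (u @ v)" "(u @ v) ! i = (u @ v) ! j"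
  consider "j < length u" | "i < length u" "length u \<le> j" | "length u \<le> i" by linarith
  then show "(u @ v) ! i \<le> (u @ v) ! s"
  proof cases
    case 1
    then show ?thesis
      using h assms(1)[unfolded nested_def, rule_format, of i s j] by (simp add: nth_append)
  next
    case 2
    then have "(u @ v) ! i \<in> set u" "(u @ v) ! j \<in> set v"
      using h(3) by (simp_all add: nth_append)
    then show ?thesis using assms(3) h(4) by auto
  next
    case 3
    define i' s' j' where d: "i' = i - length u" "s' = s - length u" "j' = j - length u"
    have e: "i = length u + i'" "s = length u + s'" "j = length u + j'" using h 3 unfolding d by linarith+
    show ?thesis
      using h assms(2)[unfolded nested_def, rule_format, of i' s' j'] unfolding e by simp
  qed
qed

lemma nested_enclose:
  assumes "nested w" "\<And>v. v \<in> set w \<Longrightarrow> m < v"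
  shows "nested (m # w @ [m])"
  unfolding nested_def
proof (intro allI impI, elim conjE)
  let ?w = "m # w @ [m]"
  fix i s j assume h: "i < s" "s < j" "j < length ?w" "?w ! i = ?w ! j"
  show "?w ! i \<le> ?w ! s"
  proof (cases "?w ! i = m")
    case True
    have "?w ! s \<in> set ?w" using h by (intro nth_mem) linarith
    then show ?thesis using assms(2)[of "?w ! s"] True by force
  next
    case False
    have "i \<noteq> 0" using False by (intro notI) simp
    moreover have "j \<noteq> Suc (length w)" using False unfolding h(4) by (intro notI) simp
    ultimately have r: "0 < i" "j < Suc (length w)" using h(3) by simp_all
    define i' s' j' where d: "i' = i - 1" "s' = s - 1" "j' = j - 1"
    have e: "i = Suc i'" "s = Suc s'" "j = Suc j'" using h r unfolding d by linarith+
    show ?thesis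
      using h r assms(1)[unfolded nested_def, rule_format, of i' s' j'] unfolding e by (simp add: nth_append)
  qed
qed

lemma nested_word:
  "heap_ordered t \<Longrightarrow> distinct (preorder t) \<Longrightarrow> nested (word t)"
proof (induction t)
  case Tip
  show ?case by (simp add: nested_def)
next
  case (Tern m a b c)
  have "nested (m # word b @ [m])"
    using Tern by (intro nested_enclose) auto
  then have "nested (word a @ (m # word b @ [m]) @ word c)"
    using Tern by (intro nested_append) auto
  then show ?case by simp
qed

lemma word_in_stirling_perms:
  assumes "t \<in> ternary_trees n"
  shows "word t \<in> stirling_perms n"
proof -
  have t: "heap_ordered t" "distinct (preorder t)" "set (preorder t) = {1..n}"
    using assms by (auto simp: ternary_trees_def)
  then have "count_list (preorder t) v = (if v \<in> {1..n} then 1 else 0)" for v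
    unfolding t(3)[symmetric] using distinct_count_atmost_1[of "preorder t"] t(2)
    by (simp add: count_mset)
  then show ?thesis
    using nested_word t by (simp add: stirling_perms_iff count_list_word)
qed

lemma append_Cons_inject:
  "x \<notin> set p \<Longrightarrow> x \<notin> set q \<Longrightarrow> p @ x # r = q @ x # s \<longleftrightarrow> p = q \<and> r = s"
proof (induction p arbitrary: q)
  case Nil then show ?case by (cases q) auto
next
  case (Cons y p) then show ?case by (cases q) auto
qed

text \<open>
  The root is the least letter of the word, and its two copies cut the word into the words of
  the subtrees, so the tree can be read off.
\<close>

lemma word_inject:
  "heap_ordered t \<Longrightarrow> distinct (preorder t) \<Longrightarrow> heap_ordered u \<Longrightarrow> distinct (preorder u) \<Longrightarrow>
     word t = word u \<Longrightarrow> t = u"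
proof (induction t arbitrary: u)
  case Tip
  then show ?case by (metis word.simps(1) word_eq_Nil)
next
  case (Tern m a b c)
  obtain m' a' b' c' where u: "u = Tern m' a' b' c'"
    using Tern.prems(5) by (cases u) auto
  have "set (word (Tern m a b c)) = set (word u)" using Tern.prems(5) by simp
  then have "insert m (set (preorder a) \<union> set (preorder b) \<union> set (preorder c)) =
      insert m' (set (preorder a') \<union> set (preorder b') \<union> set (preorder c'))"
    unfolding u by auto
  moreover have "Min (insert m (set (preorder a) \<union> set (preorder b) \<union> set (preorder c))) = m"
    using Tern.prems(1) by (intro Min_eqI) (auto intro: less_imp_le)
  moreover have "Min (insert m' (set (preorder a') \<union> set (preorder b') \<union> set (preorder c'))) = m'"
    using Tern.prems(3) unfolding u by (intro Min_eqI) (auto intro: less_imp_le)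
  ultimately have m: "m' = m" by simp
  have "m \<notin> set (word a)" "m \<notin> set (word a')" "m \<notin> set (word b)" "m \<notin> set (word b')"
    using Tern.prems unfolding u m by auto
  then have "word a = word a' \<and> word b = word b' \<and> word c = word c'"
    using Tern.prems(5) unfolding u m by (simp add: append_Cons_inject)
  then have "a = a'" "b = b'" "c = c'"
    using Tern.IH Tern.prems(1-4) unfolding u by simp_all
  then show ?case unfolding u m by simp
qed

text \<open>
  The two copies of the least letter \<open>m\<close> cut the word into three factors. A letter cannot occur on
  both sides of a copy of \<open>m\<close>, since it would enclose the smaller letter \<open>m\<close>; hence each factor
  contains both copies of each of its letters and is a word of the same kind.
\<close>

lemma word_surj:
  assumes "nested w" "\<And>v. v \<in> set w \<Longrightarrow> count_list w v = 2"
  shows "\<exists>t. heap_ordered t \<and> distinct (preorder t) \<and> word t = w"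
  using assms
proof (induction "length w" arbitrary: w rule: less_induct)
  case less
  show ?case
  proof (cases "w = []")
    case True
    then show ?thesis by (intro exI[of _ Tip]) simp
  next
    case False
    define m where "m = Min (set w)"
    have m: "m \<in> set w" "\<And>v. v \<in> set w \<Longrightarrow> m \<le> v" using False by (auto simp: m_def)
    then obtain p r where 1: "w = p @ m # r" "m \<notin> set p" by (meson split_list_first)
    have "count_list r m = 1" using less.prems(2)[OF m(1)] 1 by simp
    then have "m \<in> set r" using count_list_0_iff[of r m] by auto
    then obtain q s where 2: "r = q @ m # s" "m \<notin> set q" by (meson split_list_first)
    have 3: "m \<notin> set s" using \<open>count_list r m = 1\<close> 2 count_list_0_iff[of s m] by auto
    have w: "w = p @ m # q @ m # s" using 1 2 by simp
    have gt: "m < v" if "v \<in> set p \<union> set q \<union> set s" for v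
    proof -
      have "m \<le> v" using m(2)[of v] that w by auto
      moreover have "v \<noteq> m" using that 1 2 3 by auto
      ultimately show ?thesis by simp
    qed
    have cnt: "count_list p v + count_list q v + count_list s v = 2" if "v \<in> set p \<union> set q \<union> set s" for v
    proof -
      have "count_list w v = 2" using that by (intro less.prems(2)) (auto simp: w)
      moreover have "v \<noteq> m" using gt[OF that] by simp
      ultimately show ?thesis by (simp add: w)
    qed
    have sep: False if split: "w = x1 @ m # x2" "v \<in> set x1" "v \<in> set x2" "v \<in> set p \<union> set q \<union> set s" for x1 x2 v
    proof -
      obtain i where i: "i < length x1" "x1 ! i = v" using split(2) by (auto simp: in_set_conv_nth)
      obtain k where k: "k < length x2" "x2 ! k = v" using split(3) by (auto simp: in_set_conv_nth)
      have "w ! i = v" "w ! length x1 = m" "w ! (length x1 + Suc k) = v"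
        unfolding split(1) using i k by (simp_all add: nth_append)
      moreover have "length x1 + Suc k < length w" unfolding split(1) using k by simp
      ultimately have "v \<le> m"
        using less.prems(1)[unfolded nested_def, rule_format, of i "length x1" "length x1 + Suc k"] i by simp
      then show False using gt[OF split(4)] by simp
    qed
    have disj: "set p \<inter> set q = {}" "set p \<inter> set s = {}" "set q \<inter> set s = {}"
      using sep[of p "q @ m # s"] sep[of "p @ m # q" s] w by auto
    have pn: "nested p" "nested q" "nested s"
    proof -
      show "nested p" using less.prems(1) unfolding w by (rule nested_appendD1)
      have "nested ((p @ [m]) @ (q @ m # s))" using less.prems(1) unfolding w by simp
      then have qs: "nested (q @ m # s)" by (rule nested_appendD2)
      then show "nested q" by (rule nested_appendD1)
      have "nested ((q @ [m]) @ s)" using qs by simp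
      then show "nested s" by (rule nested_appendD2)
    qed
    have zero: "count_list xs v = 0" if "v \<notin> set xs" for xs and v :: nat
      using that by (simp add: count_list_0_iff)
    have "\<exists>a. heap_ordered a \<and> distinct (preorder a) \<and> word a = p"
    proof (rule less.hyps[OF _ pn(1)])
      fix v assume v: "v \<in> set p"
      then have "v \<notin> set q" "v \<notin> set s" using disj by auto
      then show "count_list p v = 2" using cnt[of v] v zero[of v q] zero[of v s] by simp
    qed (simp add: w)
    moreover have "\<exists>b. heap_ordered b \<and> distinct (preorder b) \<and> word b = q"
    proof (rule less.hyps[OF _ pn(2)])
      fix v assume v: "v \<in> set q"
      then have "v \<notin> set p" "v \<notin> set s" using disj by auto
      then show "count_list q v = 2" using cnt[of v] v zero[of v p] zero[of v s] by simp
    qed (simp add: w)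
    moreover have "\<exists>c. heap_ordered c \<and> distinct (preorder c) \<and> word c = s"
    proof (rule less.hyps[OF _ pn(3)])
      fix v assume v: "v \<in> set s"
      then have "v \<notin> set p" "v \<notin> set q" using disj by auto
      then show "count_list s v = 2" using cnt[of v] v zero[of v p] zero[of v q] by simp
    qed (simp add: w)
    ultimately obtain a b c where abc:
      "heap_ordered a" "distinct (preorder a)" "word a = p"
      "heap_ordered b" "distinct (preorder b)" "word b = q"
      "heap_ordered c" "distinct (preorder c)" "word c = s" by blast
    then have sets: "set p = set (preorder a)" "set q = set (preorder b)" "set s = set (preorder c)"
      using set_word by metis+
    have "heap_ordered (Tern m a b c)"
      using abc gt unfolding sets by auto
    moreover have "distinct (preorder (Tern m a b c))"
      using abc disj gt unfolding sets by auto
    ultimately show ?thesis using abc w by (intro exI[of _ "Tern m a b c"]) simp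
  qed
qed

lemma word_bij_betw: "bij_betw word (ternary_trees n) (stirling_perms n)"
proof (rule bij_betw_imageI)
  show "inj_on word (ternary_trees n)"
    by (rule inj_onI) (auto simp: ternary_trees_def intro: word_inject)
  show "word ` ternary_trees n = stirling_perms n"
  proof (intro equalityI subsetI)
    fix w assume "w \<in> word ` ternary_trees n"
    then show "w \<in> stirling_perms n" using word_in_stirling_perms by blast
  next
    fix w assume w: "w \<in> stirling_perms n"
    have "nested w" "\<And>v. v \<in> set w \<Longrightarrow> count_list w v = 2"
      using w set_stirling_perms[OF w] by (auto simp: stirling_perms_iff)
    from word_surj[OF this] obtain t where t: "heap_ordered t" "distinct (preorder t)" "word t = w"
      by blast
    have "set (preorder t) = {1..n}"
      using set_stirling_perms[OF w] set_word[of t] unfolding t(3) by simp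
    then show "w \<in> word ` ternary_trees n" using t by (auto simp: ternary_trees_def)
  qed
qed

section \<open>Reading off the gaps from the tree\<close>

lemma adjacent_Cons: "adjacent (x # y # zs) = insert (x, y) (adjacent (y # zs))"
  by (simp add: adjacent_def)

lemma adjacent_append: "adjacent (xs @ m # ys) = adjacent (xs @ [m]) \<union> adjacent (m # ys)"
proof (induction xs)
  case Nil
  show ?case by (simp add: adjacent_def)
next
  case (Cons x xs)
  then show ?case by (cases xs) (simp_all add: adjacent_Cons adjacent_def)
qed

lemma adjacent_Cons_snd: "(u, v) \<in> adjacent (x # ys) \<Longrightarrow> v \<in> set ys"
  by (auto simp: adjacent_def dest: set_zip_rightD)

lemma adjacent_snoc_fst: "(u, v) \<in> adjacent (ys @ [x]) \<Longrightarrow> u \<in> set ys"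
proof (induction ys)
  case (Cons y ys)
  then show ?case by (cases ys) (auto simp: adjacent_Cons adjacent_def)
qed (simp add: adjacent_def)

lemma first_adjacent:
  assumes "m \<notin> set w" "m \<noteq> r"
  shows "(m, v) \<in> adjacent (m # w @ [r]) \<longleftrightarrow> v = hd (w @ [r])"
proof (cases w)
  case Nil
  then show ?thesis by (auto simp: adjacent_def)
next
  case (Cons x xs)
  then show ?thesis
    using assms adjacent_snoc_fst[of m v w r] by (auto simp: adjacent_Cons)
qed

lemma last_adjacent:
  assumes "m \<notin> set w" "m \<noteq> l"
  shows "(u, m) \<in> adjacent (l # w @ [m]) \<longleftrightarrow> u = last (l # w)"
proof (cases w rule: rev_cases)
  case Nil
  then show ?thesis by (auto simp: adjacent_def)
next
  case (snoc xs x)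
  have "adjacent (l # w @ [m]) = adjacent (l # w) \<union> {(x, m)}"
    using adjacent_append[of "l # xs" x "[m]"] snoc by (simp add: adjacent_def)
  then show ?thesis
    using assms adjacent_Cons_snd[of u m l w] snoc by auto
qed

lemma prod_insert_Un3:
  assumes "finite A" "finite B" "finite C" "A \<inter> B = {}" "A \<inter> C = {}" "B \<inter> C = {}"
    "m \<notin> A" "m \<notin> B" "m \<notin> C"
  shows "prod g (insert m (A \<union> (B \<union> C))) = g m * (prod g A * (prod g B * prod g C))"
  using assms by (simp add: prod.union_disjoint Int_Un_distrib)

text \<open>
  The gaps of a letter are exactly its empty slots: a nonempty left subtree puts a
  larger letter before the first copy of the root, an empty one leaves there the smaller letter
  \<open>l\<close> that precedes the whole word, and similarly in the middle and on the right. The context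
  letters \<open>l\<close> and \<open>r\<close> are arbitrary because in the recursion the root takes over the
  role of the padding zeros.
\<close>

lemma prod_word_weight:
  assumes "heap_ordered t" "distinct (preorder t)" "\<And>v. v \<in> set (word t) \<Longrightarrow> l < v \<and> r < v"
  shows "(\<Prod>v\<in>set (word t). f (v \<in> rises (l # word t @ [r])) (v \<in> plateaux (l # word t @ [r]))
            (v \<in> drops (l # word t @ [r]))) = tree_weight f t"
  using assms
proof (induction t arbitrary: l r)
  case Tip
  show ?case by simp
next
  case (Tern m a b c)
  let ?P = "l # word (Tern m a b c) @ [r]"
  let ?A = "l # word a @ [m]" and ?B = "m # word b @ [m]" and ?C = "m # word c @ [r]"
  have adj: "adjacent ?P = adjacent ?A \<union> adjacent ?B \<union> adjacent ?C"
    using adjacent_append[of "l # word a" m "word b @ m # word c @ [r]"]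
      adjacent_append[of "m # word b" m "word c @ [r]"] by (simp add: Un_assoc)
  have gt: "m < v" if "v \<in> set (word a) \<union> set (word b) \<union> set (word c)" for v
    using that Tern.prems(1) by auto
  have lr: "l < m" "r < m" using Tern.prems(3)[of m] by simp_all
  have disj: "set (word a) \<inter> set (word b) = {}" "set (word a) \<inter> set (word c) = {}"
    "set (word b) \<inter> set (word c) = {}" "m \<notin> set (word a)" "m \<notin> set (word b)" "m \<notin> set (word c)"
    using Tern.prems(2) by auto
  have memA: "u \<in> insert l (set (word a))" "v \<in> insert m (set (word a))" if "(u, v) \<in> adjacent ?A" for u v
    using adjacent_Cons_snd[OF that] adjacent_snoc_fst[of u v "l # word a" m] that by simp_all
  have memB: "u \<in> insert m (set (word b))" "v \<in> insert m (set (word b))" if "(u, v) \<in> adjacent ?B" for u v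
    using adjacent_Cons_snd[OF that] adjacent_snoc_fst[of u v "m # word b" m] that by simp_all
  have memC: "u \<in> insert m (set (word c))" "v \<in> insert r (set (word c))" if "(u, v) \<in> adjacent ?C" for u v
    using adjacent_Cons_snd[OF that] adjacent_snoc_fst[of u v "m # word c" r] that by simp_all
  let ?f = "\<lambda>P v. f (v \<in> rises P) (v \<in> plateaux P) (v \<in> drops P)"
  have A: "?f ?P v = ?f ?A v" if v: "v \<in> set (word a)" for v
  proof -
    have ne: "v \<noteq> l" "v \<noteq> r" "v \<noteq> m" "v \<notin> set (word b)" "v \<notin> set (word c)"
      using v gt[of v] lr disj Tern.prems(3)[of v] by auto
    then have "(u, v) \<in> adjacent ?P \<longleftrightarrow> (u, v) \<in> adjacent ?A"
      "(v, u) \<in> adjacent ?P \<longleftrightarrow> (v, u) \<in> adjacent ?A" for u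
      unfolding adj using memB[of u v] memB[of v u] memC[of u v] memC[of v u] by blast+
    then show ?thesis by (simp only: rises_def plateaux_def drops_def mem_Collect_eq)
  qed
  have B: "?f ?P v = ?f ?B v" if v: "v \<in> set (word b)" for v
  proof -
    have ne: "v \<noteq> l" "v \<noteq> r" "v \<noteq> m" "v \<notin> set (word a)" "v \<notin> set (word c)"
      using v gt[of v] lr disj Tern.prems(3)[of v] by auto
    then have "(u, v) \<in> adjacent ?P \<longleftrightarrow> (u, v) \<in> adjacent ?B"
      "(v, u) \<in> adjacent ?P \<longleftrightarrow> (v, u) \<in> adjacent ?B" for u
      unfolding adj using memA[of u v] memA[of v u] memC[of u v] memC[of v u] by blast+
    then show ?thesis by (simp only: rises_def plateaux_def drops_def mem_Collect_eq)
  qed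
  have C: "?f ?P v = ?f ?C v" if v: "v \<in> set (word c)" for v
  proof -
    have ne: "v \<noteq> l" "v \<noteq> r" "v \<noteq> m" "v \<notin> set (word a)" "v \<notin> set (word b)"
      using v gt[of v] lr disj Tern.prems(3)[of v] by auto
    then have "(u, v) \<in> adjacent ?P \<longleftrightarrow> (u, v) \<in> adjacent ?C"
      "(v, u) \<in> adjacent ?P \<longleftrightarrow> (v, u) \<in> adjacent ?C" for u
      unfolding adj using memA[of u v] memA[of v u] memB[of u v] memB[of v u] by blast+
    then show ?thesis by (simp only: rises_def plateaux_def drops_def mem_Collect_eq)
  qed
  have rise: "m \<in> rises ?P \<longleftrightarrow> a = Tip"
  proof -
    have "(\<exists>u<m. (u, m) \<in> adjacent ?P) \<longleftrightarrow> (\<exists>u<m. (u, m) \<in> adjacent ?A)"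
      unfolding adj using memB memC lr disj gt by fastforce
    also have "\<dots> \<longleftrightarrow> last (l # word a) < m"
      using last_adjacent[of m "word a" l] disj lr by auto
    also have "\<dots> \<longleftrightarrow> a = Tip"
      using gt[of "last (word a)"] lr last_in_set[of "word a"] by (cases "a = Tip") auto
    finally show ?thesis by (simp only: rises_def mem_Collect_eq)
  qed
  have plateau: "m \<in> plateaux ?P \<longleftrightarrow> b = Tip"
  proof -
    have "(m, m) \<in> adjacent ?P \<longleftrightarrow> (m, m) \<in> adjacent ?B"
      unfolding adj using memA[of m m] memC[of m m] lr disj by blast
    also have "\<dots> \<longleftrightarrow> b = Tip"
    proof (cases "word b")
      case Nil
      then show ?thesis by (simp add: adjacent_def)
    next
      case (Cons x xs)
      then have "m \<notin> set (x # xs)" "b \<noteq> Tip" using disj by auto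
      then show ?thesis using Cons adjacent_snoc_fst[of m m "x # xs" m] by (auto simp: adjacent_Cons)
    qed
    finally show ?thesis by (simp only: plateaux_def mem_Collect_eq)
  qed
  have drop: "m \<in> drops ?P \<longleftrightarrow> c = Tip"
  proof -
    have "(\<exists>u<m. (m, u) \<in> adjacent ?P) \<longleftrightarrow> (\<exists>u<m. (m, u) \<in> adjacent ?C)"
      unfolding adj using memA memB lr disj gt by fastforce
    also have "\<dots> \<longleftrightarrow> hd (word c @ [r]) < m"
      using first_adjacent[of m "word c" r] disj lr by auto
    also have "\<dots> \<longleftrightarrow> c = Tip"
      using gt[of "hd (word c)"] lr hd_in_set[of "word c"] by (cases "c = Tip") auto
    finally show ?thesis by (simp only: drops_def mem_Collect_eq)
  qed
  have "set (word (Tern m a b c)) = insert m (set (word a) \<union> (set (word b) \<union> set (word c)))"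
    by auto
  then have "(\<Prod>v\<in>set (word (Tern m a b c)). ?f ?P v) =
      ?f ?P m * ((\<Prod>v\<in>set (word a). ?f ?P v) * ((\<Prod>v\<in>set (word b). ?f ?P v) * (\<Prod>v\<in>set (word c). ?f ?P v)))"
    using prod_insert_Un3[OF finite_set finite_set finite_set disj, of "?f ?P"] by (simp only:)
  also have "(\<Prod>v\<in>set (word a). ?f ?P v) = tree_weight f a"
  proof (rule trans[OF prod.cong[OF refl A]])
    show "(\<Prod>v\<in>set (word a). ?f ?A v) = tree_weight f a"
      using Tern.prems gt lr by (intro Tern.IH(1)) auto
  qed
  also have "(\<Prod>v\<in>set (word b). ?f ?P v) = tree_weight f b"
  proof (rule trans[OF prod.cong[OF refl B]])
    show "(\<Prod>v\<in>set (word b). ?f ?B v) = tree_weight f b"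
      using Tern.prems gt lr by (intro Tern.IH(2)) auto
  qed
  also have "(\<Prod>v\<in>set (word c). ?f ?P v) = tree_weight f c"
  proof (rule trans[OF prod.cong[OF refl C]])
    show "(\<Prod>v\<in>set (word c). ?f ?C v) = tree_weight f c"
      using Tern.prems gt lr by (intro Tern.IH(3)) auto
  qed
  finally show ?case
    unfolding rise plateau drop tree_weight.simps .
qed

section \<open>Forgetting the slots: from ternary trees to plane trees\<close>

text \<open>
  The result is a list, of length at most one, so that empty slots vanish under concatenation.
\<close>

primrec flatten :: "ternary \<Rightarrow> ptree list" where
  "flatten Tip = []"
| "flatten (Tern m a b c) = [Node m (flatten a @ flatten b @ flatten c)]"

text \<open>
  The sum of the vertex weights over all choices of \<open>d\<close> occupied slots among three.
\<close>

definition degree_weight :: "(bool \<Rightarrow> bool \<Rightarrow> bool \<Rightarrow> 'a::comm_ring_1) \<Rightarrow> nat \<Rightarrow> 'a" where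
  "degree_weight f d =
    (if d = 0 then f True True True
     else if d = 1 then f False True True + f True False True + f True True False
     else if d = 2 then f False False True + f False True False + f True False False
     else f False False False)"

lemma flatten_eq_Nil [simp]: "flatten t = [] \<longleftrightarrow> t = Tip"
  by (cases t) auto

lemma labels_flatten: "concat (map labels (flatten t)) = preorder t"
  by (induction t) auto

lemma length_flatten: "length (flatten t) = (if t = Tip then 0 else 1)"
  by (cases t) auto

lemma degrees_flatten: "p \<in> set (flatten t) \<Longrightarrow> d \<in> set (degrees p) \<Longrightarrow> d \<le> 3"
  by (induction t arbitrary: p) (auto simp: length_flatten)

lemma increasing_Node:
  "increasing (Node m ts) \<longleftrightarrow> (\<forall>t\<in>set ts. m < label t \<and> increasing t)"
  by (auto intro: increasing.intros elim: increasing.cases)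

lemma label_in_labels: "label p \<in> set (labels p)"
  by (cases p) simp

lemma increasing_label_le: "increasing p \<Longrightarrow> v \<in> set (labels p) \<Longrightarrow> label p \<le> v"
proof (induction p arbitrary: v)
  case (Node m ts)
  show ?case
  proof (cases "v = m")
    case False
    then obtain t where t: "t \<in> set ts" "v \<in> set (labels t)" using Node.prems(2) by auto
    then have "m < label t" "increasing t" using Node.prems(1) by (auto simp: increasing_Node)
    then have "m \<le> v" using Node.IH[OF t(1) _ t(2)] by simp
    then show ?thesis by simp
  qed simp
qed

text \<open>
  Heap order of ternary trees compares a vertex with all its descendants, while \<open>increasing\<close>
  compares it with its children only; this is the bridge between the two.
\<close>

lemma increasing_Node_labels:
  "increasing (Node m ts) \<longleftrightarrow>
     (\<forall>v \<in> set (concat (map labels ts)). m < v) \<and> (\<forall>t\<in>set ts. increasing t)"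
proof
  assume "increasing (Node m ts)"
  then show "(\<forall>v \<in> set (concat (map labels ts)). m < v) \<and> (\<forall>t\<in>set ts. increasing t)"
    using increasing_label_le by (fastforce simp: increasing_Node)
next
  assume "(\<forall>v \<in> set (concat (map labels ts)). m < v) \<and> (\<forall>t\<in>set ts. increasing t)"
  then show "increasing (Node m ts)"
    using label_in_labels by (auto simp: increasing_Node)
qed

lemma heap_ordered_iff_increasing: "heap_ordered t \<longleftrightarrow> (\<forall>p\<in>set (flatten t). increasing p)"
  by (induction t) (auto simp: increasing_Node_labels labels_flatten ball_Un)

lemma flatten_surj: "(\<And>d. d \<in> set (degrees p) \<Longrightarrow> d \<le> 3) \<Longrightarrow> \<exists>t. flatten t = [p]"
proof (induction p)
  case (Node m ts)
  have ex: "\<exists>t. flatten t = [s]" if "s \<in> set ts" for s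
    using Node.IH[OF that] Node.prems that by auto
  have "length ts \<le> 3" using Node.prems[of "length ts"] by simp
  then consider "ts = []" | s where "ts = [s]" | s u where "ts = [s, u]" | s u v where "ts = [s, u, v]"
    by (cases ts; cases "tl ts"; cases "tl (tl ts)") auto
  then show ?case
  proof cases
    case 1
    then show ?thesis by (intro exI[of _ "Tern m Tip Tip Tip"]) simp
  next
    case (2 s)
    then obtain a where "flatten a = [s]" using ex by auto
    then show ?thesis using 2 by (intro exI[of _ "Tern m a Tip Tip"]) simp
  next
    case (3 s u)
    then obtain a b where "flatten a = [s]" "flatten b = [u]" using ex[of s] ex[of u] by auto
    then show ?thesis using 3 by (intro exI[of _ "Tern m a b Tip"]) simp
  next
    case (4 s u v)
    then obtain a b c where "flatten a = [s]" "flatten b = [u]" "flatten c = [v]"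
      using ex[of s] ex[of u] ex[of v] by auto
    then show ?thesis using 4 by (intro exI[of _ "Tern m a b c"]) simp
  qed
qed

text \<open>
  Prescribing independently the three slots of the root decomposes a fibre of \<open>flatten\<close> into
  boxes, one for each choice of the occupied slots, over which the weight factorises.
\<close>

definition Tern_box :: "nat \<Rightarrow> ternary set \<Rightarrow> ternary set \<Rightarrow> ternary set \<Rightarrow> ternary set" where
  "Tern_box m A B C = (\<lambda>(a, b, c). Tern m a b c) ` (A \<times> B \<times> C)"

lemma Tern_box_iff:
  "t \<in> Tern_box m A B C \<longleftrightarrow> (\<exists>a b c. t = Tern m a b c \<and> a \<in> A \<and> b \<in> B \<and> c \<in> C)"
  by (force simp: Tern_box_def)

lemma finite_Tern_box: "finite A \<Longrightarrow> finite B \<Longrightarrow> finite C \<Longrightarrow> finite (Tern_box m A B C)"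
  by (simp add: Tern_box_def)

lemma sum_Tern_box:
  assumes "if \<alpha> then A = {Tip} else Tip \<notin> A" "if \<beta> then B = {Tip} else Tip \<notin> B"
    "if \<gamma> then C = {Tip} else Tip \<notin> C"
  shows "sum (tree_weight f) (Tern_box m A B C) =
    f \<alpha> \<beta> \<gamma> * (sum (tree_weight f) A * (sum (tree_weight f) B * sum (tree_weight f) C))"
proof -
  have "inj_on (\<lambda>(a, b, c). Tern m a b c) (A \<times> B \<times> C)" by (auto simp: inj_on_def)
  then have "sum (tree_weight f) (Tern_box m A B C) =
      (\<Sum>(a, b, c)\<in>A \<times> B \<times> C. tree_weight f (Tern m a b c))"
    unfolding Tern_box_def by (simp add: sum.reindex case_prod_unfold)
  also have "\<dots> = (\<Sum>a\<in>A. \<Sum>b\<in>B. \<Sum>c\<in>C. tree_weight f (Tern m a b c))"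
    by (simp only: sum.cartesian_product)
  also have "\<dots> = (\<Sum>a\<in>A. \<Sum>b\<in>B. \<Sum>c\<in>C. f \<alpha> \<beta> \<gamma> * (tree_weight f a * (tree_weight f b * tree_weight f c)))"
  proof (intro sum.cong refl)
    fix a b c assume "a \<in> A" "b \<in> B" "c \<in> C"
    with assms have "(a = Tip) = \<alpha>" "(b = Tip) = \<beta>" "(c = Tip) = \<gamma>"
      by (auto split: if_splits)
    then show "tree_weight f (Tern m a b c) =
        f \<alpha> \<beta> \<gamma> * (tree_weight f a * (tree_weight f b * tree_weight f c))" by simp
  qed
  also have "\<dots> = f \<alpha> \<beta> \<gamma> * (sum (tree_weight f) A * (sum (tree_weight f) B * sum (tree_weight f) C))"
    by (simp only: sum_distrib_left[symmetric] sum_distrib_right[symmetric])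
  finally show ?thesis .
qed

lemma sum_Un3:
  assumes "finite A" "finite B" "finite C" "A \<inter> B = {}" "A \<inter> C = {}" "B \<inter> C = {}"
  shows "sum g (A \<union> B \<union> C) = sum g A + sum g B + sum g C"
  using assms by (simp add: sum.union_disjoint Int_Un_distrib2)

definition fibre :: "ptree \<Rightarrow> ternary set" where
  "fibre p = {t. flatten t = [p]}"

lemma Tip_notin_fibre [simp]: "Tip \<notin> fibre p"
  by (simp add: fibre_def)

text \<open>
  The children of the root keep their order, so a tree in the fibre is given by the slots that
  they occupy and by an independent choice of a tree in the fibre of each child.
\<close>

lemma sum_fibre:
  assumes "\<And>d. d \<in> set (degrees p) \<Longrightarrow> d \<le> 3"
  shows "finite (fibre p) \<and>
    sum (tree_weight f) (fibre p) = prod_list (map (degree_weight f) (degrees p))"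
  using assms
proof (induction p)
  case (Node m ts)
  have fin: "finite (fibre s)"
    and sum: "sum (tree_weight f) (fibre s) = prod_list (map (degree_weight f) (degrees s))"
    if "s \<in> set ts" for s
    using Node.IH[OF that] Node.prems that by auto
  let ?E = "{Tip}"
  have mem: "t \<in> fibre (Node m ts) \<longleftrightarrow>
      (\<exists>a b c. t = Tern m a b c \<and> flatten a @ flatten b @ flatten c = ts)" for t
    by (cases t) (auto simp: fibre_def)
  have "length ts \<le> 3" using Node.prems[of "length ts"] by simp
  then consider "ts = []" | s where "ts = [s]" | s u where "ts = [s, u]" | s u v where "ts = [s, u, v]"
    by (cases ts; cases "tl ts"; cases "tl (tl ts)") auto
  then show ?case
  proof cases
    case 1
    have "fibre (Node m ts) = Tern_box m ?E ?E ?E"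
      unfolding set_eq_iff mem Tern_box_iff unfolding 1 by auto
    then show ?thesis
      using 1 by (simp add: finite_Tern_box sum_Tern_box[of True "?E" True "?E" True "?E"] degree_weight_def)
  next
    case (2 s)
    have split: "flatten a @ flatten b @ flatten c = [s] \<longleftrightarrow>
        flatten a = [s] \<and> b = Tip \<and> c = Tip \<or> a = Tip \<and> flatten b = [s] \<and> c = Tip \<or>
        a = Tip \<and> b = Tip \<and> flatten c = [s]" for a b c
      by (cases a; cases b; cases c) auto
    have eq: "fibre (Node m ts) =
        Tern_box m (fibre s) ?E ?E \<union> Tern_box m ?E (fibre s) ?E \<union> Tern_box m ?E ?E (fibre s)"
      unfolding set_eq_iff mem Un_iff Tern_box_iff unfolding 2 split by (auto simp: fibre_def)
    have f: "finite (fibre s)" using fin 2 by simp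
    have "sum (tree_weight f) (fibre (Node m ts)) =
        sum (tree_weight f) (Tern_box m (fibre s) ?E ?E) +
        sum (tree_weight f) (Tern_box m ?E (fibre s) ?E) +
        sum (tree_weight f) (Tern_box m ?E ?E (fibre s))"
      unfolding eq using f by (intro sum_Un3 finite_Tern_box) (auto simp: Tern_box_iff)
    also have "\<dots> = degree_weight f 1 * sum (tree_weight f) (fibre s)"
      by (simp add: sum_Tern_box[of False "fibre s" True "?E" True "?E"] sum_Tern_box[of True "?E" False "fibre s" True "?E"] sum_Tern_box[of True "?E" True "?E" False "fibre s"]
          degree_weight_def distrib_right)
    finally show ?thesis
      using f sum[of s] 2 unfolding eq by (simp add: finite_Tern_box)
  next
    case (3 s u)
    have split: "flatten a @ flatten b @ flatten c = [s, u] \<longleftrightarrow>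
        flatten a = [s] \<and> flatten b = [u] \<and> c = Tip \<or> flatten a = [s] \<and> b = Tip \<and> flatten c = [u] \<or>
        a = Tip \<and> flatten b = [s] \<and> flatten c = [u]" for a b c
      by (cases a; cases b; cases c) auto
    have eq: "fibre (Node m ts) = Tern_box m (fibre s) (fibre u) ?E \<union>
        Tern_box m (fibre s) ?E (fibre u) \<union> Tern_box m ?E (fibre s) (fibre u)"
      unfolding set_eq_iff mem Un_iff Tern_box_iff unfolding 3 split by (auto simp: fibre_def)
    have f: "finite (fibre s)" "finite (fibre u)" using fin 3 by simp_all
    have "sum (tree_weight f) (fibre (Node m ts)) =
        sum (tree_weight f) (Tern_box m (fibre s) (fibre u) ?E) +
        sum (tree_weight f) (Tern_box m (fibre s) ?E (fibre u)) +
        sum (tree_weight f) (Tern_box m ?E (fibre s) (fibre u))"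
      unfolding eq using f by (intro sum_Un3 finite_Tern_box) (auto simp: Tern_box_iff)
    also have "\<dots> = degree_weight f 2 * (sum (tree_weight f) (fibre s) * sum (tree_weight f) (fibre u))"
      by (simp add: sum_Tern_box[of False "fibre s" False "fibre u" True "?E"] sum_Tern_box[of False "fibre s" True "?E" False "fibre u"] sum_Tern_box[of True "?E" False "fibre s" False "fibre u"]
          degree_weight_def distrib_right)
    finally show ?thesis
      using f sum[of s] sum[of u] 3 unfolding eq by (simp add: finite_Tern_box numeral_2_eq_2)
  next
    case (4 s u v)
    have split: "flatten a @ flatten b @ flatten c = [s, u, v] \<longleftrightarrow>
        flatten a = [s] \<and> flatten b = [u] \<and> flatten c = [v]" for a b c
      by (cases a; cases b; cases c) auto
    have eq: "fibre (Node m ts) = Tern_box m (fibre s) (fibre u) (fibre v)"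
      unfolding set_eq_iff mem Tern_box_iff unfolding 4 split by (auto simp: fibre_def)
    have f: "finite (fibre s)" "finite (fibre u)" "finite (fibre v)" using fin 4 by simp_all
    have "degree_weight f (Suc (Suc (Suc 0))) = f False False False" by (simp add: degree_weight_def)
    then show ?thesis
      using f sum[of s] sum[of u] sum[of v] 4 unfolding eq
      by (simp add: finite_Tern_box sum_Tern_box[of False "fibre s" False "fibre u" False "fibre v"])
  qed
qed

lemma ternary_trees_eq_Union_fibre:
  assumes "n \<ge> 1"
  shows "ternary_trees n = (\<Union>p\<in>trees_0123 n. fibre p)"
proof (intro equalityI subsetI)
  fix t assume t: "t \<in> ternary_trees n"
  then have "t \<noteq> Tip" using assms by (auto simp: ternary_trees_def)
  then obtain p where p: "flatten t = [p]" by (cases t) auto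
  have l: "labels p = preorder t" using labels_flatten[of t] p by simp
  have inc: "increasing p" using t p by (simp add: ternary_trees_def heap_ordered_iff_increasing)
  have s: "set (labels p) = {1..n}" "distinct (labels p)" using t l by (auto simp: ternary_trees_def)
  have "label p \<le> 1" using increasing_label_le[OF inc, of 1] s assms by simp
  moreover have "1 \<le> label p" using label_in_labels[of p] s by simp
  ultimately have "label p = 1" by simp
  then have "p \<in> trees_0123 n"
    using inc s degrees_flatten[of p t] p by (auto simp: trees_0123_def increasing_plane_trees_def)
  then show "t \<in> (\<Union>p\<in>trees_0123 n. fibre p)" using p by (auto simp: fibre_def)
next
  fix t assume "t \<in> (\<Union>p\<in>trees_0123 n. fibre p)"
  then obtain p where p: "p \<in> trees_0123 n" "flatten t = [p]" by (auto simp: fibre_def)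
  then show "t \<in> ternary_trees n"
    using labels_flatten[of t]
    by (auto simp: ternary_trees_def heap_ordered_iff_increasing trees_0123_def increasing_plane_trees_def)
qed

lemma finite_stirling_perms: "finite (stirling_perms n)"
proof (rule finite_subset)
  show "stirling_perms n \<subseteq> {xs. set xs \<subseteq> {1..n} \<and> length xs = 2 * n}"
  proof
    fix \<sigma> assume s: "\<sigma> \<in> stirling_perms n"
    then have "size (mset \<sigma>) = 2 * n" by (simp add: stirling_perms_def)
    then show "\<sigma> \<in> {xs. set xs \<subseteq> {1..n} \<and> length xs = 2 * n}"
      using set_stirling_perms[OF s] by simp
  qed
  show "finite {xs. set xs \<subseteq> {1..n} \<and> length xs = 2 * n}"
    by (rule finite_lists_length_eq) simp
qed

lemma finite_trees_0123:
  assumes "n \<ge> 1"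
  shows "finite (trees_0123 n)"
proof (rule finite_subset)
  show "trees_0123 n \<subseteq> (\<lambda>t. hd (flatten t)) ` ternary_trees n"
  proof
    fix p assume p: "p \<in> trees_0123 n"
    then obtain t where t: "flatten t = [p]" using flatten_surj[of p] by (auto simp: trees_0123_def)
    then have "t \<in> ternary_trees n"
      using p by (auto simp: ternary_trees_eq_Union_fibre[OF assms] fibre_def)
    then show "p \<in> (\<lambda>t. hd (flatten t)) ` ternary_trees n" using t by force
  qed
  show "finite ((\<lambda>t. hd (flatten t)) ` ternary_trees n)"
    using bij_betw_finite[OF word_bij_betw, of n] finite_stirling_perms by simp
qed

lemma sum_ternary_trees:
  assumes "n \<ge> 1"
  shows "sum (tree_weight f) (ternary_trees n) =
    (\<Sum>p\<in>trees_0123 n. prod_list (map (degree_weight f) (degrees p)))"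
proof -
  have deg: "\<And>d. d \<in> set (degrees p) \<Longrightarrow> d \<le> 3" if "p \<in> trees_0123 n" for p
    using that by (auto simp: trees_0123_def)
  have "sum (tree_weight f) (ternary_trees n) = (\<Sum>p\<in>trees_0123 n. sum (tree_weight f) (fibre p))"
    unfolding ternary_trees_eq_Union_fibre[OF assms]
    by (rule sum.UNION_disjoint)
      (use finite_trees_0123[OF assms] sum_fibre deg in \<open>auto simp: fibre_def\<close>)
  also have "\<dots> = (\<Sum>p\<in>trees_0123 n. prod_list (map (degree_weight f) (degrees p)))"
    by (intro sum.cong refl sum_fibre[THEN conjunct2] deg)
  finally show ?thesis .
qed

lemma prod_list_degree_weight:
  assumes "\<And>d. d \<in> set ds \<Longrightarrow> d \<le> 3" "f False False False = 1"
  shows "prod_list (map (degree_weight f) ds) =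
    degree_weight f 2 ^ count_list ds 2 * degree_weight f 1 ^ count_list ds 1 *
    degree_weight f 0 ^ count_list ds 0"
  using assms(1)
proof (induction ds)
  case (Cons d ds)
  then have "d \<le> 3" by simp
  then consider "d = 0" | "d = 1" | "d = 2" | "d = 3" by linarith
  moreover have "degree_weight f 3 = 1" using assms(2) by (simp add: degree_weight_def)
  ultimately show ?case using Cons by cases (simp_all add: mult_ac)
qed simp

lemma length_degrees: "length (degrees p) = length (labels p)"
  by (induction p) (auto simp: length_concat intro!: arg_cong[of _ _ sum_list] map_cong)

text \<open>Every vertex except the root is the child of exactly one vertex.\<close>

lemma sum_degrees: "Suc (sum_list (degrees p)) = length (degrees p)"
proof (induction p)
  case (Node m ts)
  have "length us + sum_list (concat (map degrees us)) = length (concat (map degrees us))"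
    if "\<And>u. u \<in> set us \<Longrightarrow> Suc (sum_list (degrees u)) = length (degrees u)" for us
    using that by (induction us) (simp_all, metis add_Suc_right add.left_commute add.commute add_Suc)
  then show ?case using Node by simp
qed

text \<open>
  A vertex of degree \<open>d\<close> has \<open>3 - d\<close> empty slots; with the edge count in \<open>sum_degrees\<close> this gives
  the linear relation that defines the index set.
\<close>

lemma degree_counts:
  assumes "\<And>d. d \<in> set ds \<Longrightarrow> d \<le> (3::nat)"
  shows "3 * length ds = sum_list ds + count_list ds 2 + 2 * count_list ds 1 + 3 * count_list ds 0"
  using assms
proof (induction ds)
  case (Cons d ds)
  then have "d \<le> 3" by simp
  then consider "d = 0" | "d = 1" | "d = 2" | "d = 3" by linarith
  then show ?case using Cons by cases simp_all
qed simp

lemma trees_0123_indices: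
  assumes "p \<in> trees_0123 n"
  shows "(num_degree 2 p, num_degree 1 p, num_degree 0 p) \<in> gamma_indices n"
proof -
  have "distinct (labels p)" "set (labels p) = {1..n}" "\<And>d. d \<in> set (degrees p) \<Longrightarrow> d \<le> 3"
    using assms by (auto simp: trees_0123_def increasing_plane_trees_def)
  moreover from this have "length (degrees p) = n"
    unfolding length_degrees using distinct_card by fastforce
  ultimately show ?thesis
    using degree_counts[of "degrees p"] sum_degrees[of p]
    by (simp add: gamma_indices_def num_degree_def)
qed

lemma finite_gamma_indices: "finite (gamma_indices n)"
  by (rule finite_subset[of _ "{..2*n+1} \<times> {..2*n+1} \<times> {..2*n+1}"]) (auto simp: gamma_indices_def)

definition tree_count :: "nat \<Rightarrow> nat \<Rightarrow> nat \<Rightarrow> nat \<Rightarrow> nat" where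
  "tree_count n i j k =
    card {t \<in> trees_0123 n. num_degree 0 t = k \<and> num_degree 1 t = j \<and> num_degree 2 t = i}"

lemma sum_ternary_trees_expansion:
  assumes "n \<ge> 1" "f False False False = 1"
  shows "sum (tree_weight f) (ternary_trees n) =
    (\<Sum>(i, j, k)\<in>gamma_indices n. of_nat (tree_count n i j k) *
       degree_weight f 2 ^ i * degree_weight f 1 ^ j * degree_weight f 0 ^ k)"
proof -
  let ?idx = "\<lambda>p. (num_degree 2 p, num_degree 1 p, num_degree 0 p)"
  let ?m = "\<lambda>(i, j, k). degree_weight f 2 ^ i * degree_weight f 1 ^ j * degree_weight f 0 ^ k"
  have "sum (tree_weight f) (ternary_trees n) = (\<Sum>p\<in>trees_0123 n. ?m (?idx p))"
    unfolding sum_ternary_trees[OF assms(1)]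
  proof (rule sum.cong[OF refl])
    fix p assume "p \<in> trees_0123 n"
    then have "\<And>d. d \<in> set (degrees p) \<Longrightarrow> d \<le> 3" by (simp add: trees_0123_def)
    from prod_list_degree_weight[where f = f, OF this assms(2)]
    show "prod_list (map (degree_weight f) (degrees p)) = ?m (?idx p)" by (simp add: num_degree_def)
  qed
  also have "\<dots> = (\<Sum>q\<in>gamma_indices n. \<Sum>p\<in>{p \<in> trees_0123 n. ?idx p = q}. ?m (?idx p))"
    using trees_0123_indices
    by (intro sum.group[symmetric] finite_trees_0123 finite_gamma_indices assms(1)) blast
  also have "\<dots> = (\<Sum>q\<in>gamma_indices n. of_nat (card {p \<in> trees_0123 n. ?idx p = q}) * ?m q)"
    by (intro sum.cong refl) simp
  also have "\<dots> = (\<Sum>(i, j, k)\<in>gamma_indices n. of_nat (tree_count n i j k) *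
       degree_weight f 2 ^ i * degree_weight f 1 ^ j * degree_weight f 0 ^ k)"
  proof (intro sum.cong refl)
    fix q :: "nat \<times> nat \<times> nat"
    obtain i j k where q: "q = (i, j, k)" by (cases q)
    have "{p \<in> trees_0123 n. ?idx p = q} =
        {t \<in> trees_0123 n. num_degree 0 t = k \<and> num_degree 1 t = j \<and> num_degree 2 t = i}"
      unfolding q by auto
    then show "of_nat (card {p \<in> trees_0123 n. ?idx p = q}) * ?m q =
        (case q of (i, j, k) \<Rightarrow> of_nat (tree_count n i j k) *
          degree_weight f 2 ^ i * degree_weight f 1 ^ j * degree_weight f 0 ^ k)"
      unfolding q by (simp add: tree_count_def mult.assoc)
  qed
  finally show ?thesis .
qed

section \<open>The expansions of the two generating polynomials\<close>

text \<open>
  The common source of both expansions, for an arbitrary weight in terms of the gaps of each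
  letter. Vertices of degree three are normalised to weight one, so that the three remaining degree
  counts, which form the index \<open>(i, j, k)\<close>, determine the contribution of a plane tree.
\<close>

lemma sum_stirling_perms_expansion:
  assumes "n \<ge> 1" "f False False False = 1"
  shows "(\<Sum>\<sigma>\<in>stirling_perms n. \<Prod>v\<in>set \<sigma>. f (v \<in> rises (pad \<sigma>)) (v \<in> plateaux (pad \<sigma>)) (v \<in> drops (pad \<sigma>))) =
    (\<Sum>(i, j, k)\<in>gamma_indices n. of_nat (tree_count n i j k) *
       degree_weight f 2 ^ i * degree_weight f 1 ^ j * degree_weight f 0 ^ k)"
    (is "sum ?g _ = _")
proof -
  have "sum ?g (stirling_perms n) = (\<Sum>t\<in>ternary_trees n. ?g (word t))"
    by (rule sum.reindex_bij_betw[OF word_bij_betw, symmetric])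
  also have "\<dots> = sum (tree_weight f) (ternary_trees n)"
  proof (rule sum.cong[OF refl])
    fix t assume "t \<in> ternary_trees n"
    then show "?g (word t) = tree_weight f t"
      by (intro prod_word_weight) (auto simp: ternary_trees_def)
  qed
  finally show ?thesis using sum_ternary_trees_expansion[where f = f, OF assms] by (simp only:)
qed

lemma power_card_eq_prod:
  assumes "finite V" "S \<subseteq> V"
  shows "(x :: 'a::comm_monoid_mult) ^ card S = (\<Prod>v\<in>V. if v \<in> S then x else 1)"
proof -
  have "V \<inter> S = S" using assms(2) by auto
  then show ?thesis using prod.inter_restrict[OF assms(1), of "\<lambda>_. x" S] by simp
qed

lemma rises_subset: "rises (pad \<sigma>) \<subseteq> set \<sigma>"
proof
  fix v assume "v \<in> rises (pad \<sigma>)"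
  then obtain u where "(u, v) \<in> adjacent (pad \<sigma>)" "u < v" by (auto simp: rises_def)
  then show "v \<in> set \<sigma>" using adjacent_Cons_snd[of u v 0 "\<sigma> @ [0]"] by auto
qed

lemma drops_subset: "drops (pad \<sigma>) \<subseteq> set \<sigma>"
proof
  fix v assume "v \<in> drops (pad \<sigma>)"
  then obtain u where "(v, u) \<in> adjacent ((0 # \<sigma>) @ [0])" "u < v" by (auto simp: drops_def)
  then show "v \<in> set \<sigma>" using adjacent_snoc_fst[of v u "0 # \<sigma>" 0] by auto
qed

lemma plateaux_subset:
  assumes "\<sigma> \<in> stirling_perms n" "n \<ge> 1"
  shows "plateaux (pad \<sigma>) \<subseteq> set \<sigma>"
proof
  fix v assume "v \<in> plateaux (pad \<sigma>)"
  then obtain i where "1 \<le> i" "i \<le> length \<sigma> - 1" "letter \<sigma> i = v"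
    unfolding plateaux_pad[OF assms] by auto
  then show "v \<in> set \<sigma>"
    using stirling_perms_letter_range[OF assms(1), of i] set_stirling_perms[OF assms(1)] by auto
qed

lemma C_poly_expansion:
  fixes x y z :: "'a::comm_ring_1"
  assumes "n \<ge> 1"
  shows "C_poly n x y z = (\<Sum>(i, j, k)\<in>gamma_indices n.
    of_nat (tree_count n i j k) * (x + y + z) ^ i * (x * y + y * z + z * x) ^ j * (x * y * z) ^ k)"
proof -
  define f :: "bool \<Rightarrow> bool \<Rightarrow> bool \<Rightarrow> 'a" where
    "f = (\<lambda>a p d. (if a then x else 1) * (if d then y else 1) * (if p then z else 1))"
  have "C_poly n x y z = (\<Sum>\<sigma>\<in>stirling_perms n. \<Prod>v\<in>set \<sigma>.
      f (v \<in> rises (pad \<sigma>)) (v \<in> plateaux (pad \<sigma>)) (v \<in> drops (pad \<sigma>)))"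
    unfolding C_poly_def
  proof (rule sum.cong[OF refl])
    fix \<sigma> assume s: "\<sigma> \<in> stirling_perms n"
    show "x ^ asc \<sigma> * y ^ des \<sigma> * z ^ plat \<sigma> = (\<Prod>v\<in>set \<sigma>.
        f (v \<in> rises (pad \<sigma>)) (v \<in> plateaux (pad \<sigma>)) (v \<in> drops (pad \<sigma>)))"
      unfolding f_def asc_eq_card[OF s] des_eq_card[OF s] plat_eq_card[OF s assms] prod.distrib
        power_card_eq_prod[OF finite_set rises_subset] power_card_eq_prod[OF finite_set drops_subset]
        power_card_eq_prod[OF finite_set plateaux_subset[OF s assms]] ..
  qed
  also have "\<dots> = (\<Sum>(i, j, k)\<in>gamma_indices n. of_nat (tree_count n i j k) *
       degree_weight f 2 ^ i * degree_weight f 1 ^ j * degree_weight f 0 ^ k)"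
    by (rule sum_stirling_perms_expansion[OF assms]) (simp add: f_def)
  also have "degree_weight f 2 = x + y + z" by (simp add: degree_weight_def f_def add_ac)
  also have "degree_weight f 1 = x * y + y * z + z * x"
    by (simp add: degree_weight_def f_def add_ac mult_ac)
  also have "degree_weight f 0 = x * y * z" by (simp add: degree_weight_def f_def)
  finally show ?thesis .
qed

lemma N_poly_expansion:
  fixes x y z :: "'a::comm_ring_1"
  assumes "n \<ge> 1"
  shows "N_poly n x y z = (\<Sum>(i, j, k)\<in>gamma_indices n.
    of_nat (tree_count n i j k) * 3 ^ i * (x + y + z) ^ j * (x * y * z) ^ k)"
proof -
  define f :: "bool \<Rightarrow> bool \<Rightarrow> bool \<Rightarrow> 'a" where
    "f = (\<lambda>a p d. (if a \<and> p then x else 1) * (if a \<and> d then y else 1) * (if p \<and> d then z else 1))"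
  have "N_poly n x y z = (\<Sum>\<sigma>\<in>stirling_perms n. \<Prod>v\<in>set \<sigma>.
      f (v \<in> rises (pad \<sigma>)) (v \<in> plateaux (pad \<sigma>)) (v \<in> drops (pad \<sigma>)))"
    unfolding N_poly_def
  proof (rule sum.cong[OF refl])
    fix \<sigma> assume s: "\<sigma> \<in> stirling_perms n"
    have sub: "rises (pad \<sigma>) \<inter> plateaux (pad \<sigma>) \<subseteq> set \<sigma>" "rises (pad \<sigma>) \<inter> drops (pad \<sigma>) \<subseteq> set \<sigma>"
      "plateaux (pad \<sigma>) \<inter> drops (pad \<sigma>) \<subseteq> set \<sigma>"
      using rises_subset[of \<sigma>] drops_subset[of \<sigma>] by blast+
    show "x ^ lap \<sigma> * y ^ eud \<sigma> * z ^ rpd \<sigma> = (\<Prod>v\<in>set \<sigma>.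
        f (v \<in> rises (pad \<sigma>)) (v \<in> plateaux (pad \<sigma>)) (v \<in> drops (pad \<sigma>)))"
      unfolding f_def lap_eq_card[OF s assms] eud_eq_card[OF s] rpd_eq_card[OF s assms] prod.distrib
        power_card_eq_prod[OF finite_set sub(1)] power_card_eq_prod[OF finite_set sub(2)]
        power_card_eq_prod[OF finite_set sub(3)] Int_iff ..
  qed
  also have "\<dots> = (\<Sum>(i, j, k)\<in>gamma_indices n. of_nat (tree_count n i j k) *
       degree_weight f 2 ^ i * degree_weight f 1 ^ j * degree_weight f 0 ^ k)"
    by (rule sum_stirling_perms_expansion[OF assms]) (simp add: f_def)
  also have "degree_weight f 2 = 3" by (simp add: degree_weight_def f_def)
  also have "degree_weight f 1 = x + y + z" by (simp add: degree_weight_def f_def add_ac)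
  also have "degree_weight f 0 = x * y * z" by (simp add: degree_weight_def f_def)
  finally show ?thesis .
qed

section \<open>Uniqueness of the coefficients\<close>

text \<open>
  Put \<open>M = 2 * n + 3\<close>. The value equals \<open>M * (i + j + k) + (j + k)\<close>, and \<open>j + k < M\<close> on the index
  set, so the base \<open>M\<close> digits recover \<open>i\<close> and \<open>j + k\<close>; the weight \<open>i + 2 * j + 3 * k = 2 * n + 1\<close>
  then separates \<open>j\<close> from \<open>k\<close>.
\<close>

lemma inj_on_gamma_degree:
  "inj_on (\<lambda>(i, j, k). (2 * n + 3) * i + (2 * n + 4) * j + (2 * n + 4) * k) (gamma_indices n)"
proof (rule inj_onI)
  fix q q' :: "nat \<times> nat \<times> nat"
  let ?M = "2 * n + 3" and ?D = "\<lambda>(i, j, k). (2 * n + 3) * i + (2 * n + 4) * j + (2 * n + 4) * k"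
  assume "q \<in> gamma_indices n" "q' \<in> gamma_indices n" "?D q = ?D q'"
  moreover obtain i j k i' j' k' where q: "q = (i, j, k)" "q' = (i', j', k')" by (cases q, cases q')
  ultimately have g: "(i, j, k) \<in> gamma_indices n" "(i', j', k') \<in> gamma_indices n"
    and eq: "?M * i + (2 * n + 4) * j + (2 * n + 4) * k = ?M * i' + (2 * n + 4) * j' + (2 * n + 4) * k'"
    by simp_all
  have lt: "j + k < ?M" "j' + k' < ?M" using g by (auto simp: gamma_indices_def)
  have "(j + k) + ?M * (i + j + k) = (j' + k') + ?M * (i' + j' + k')"
    using eq by (simp add: algebra_simps)
  then have "((j + k) + ?M * (i + j + k)) mod ?M = ((j' + k') + ?M * (i' + j' + k')) mod ?M"
    "((j + k) + ?M * (i + j + k)) div ?M = ((j' + k') + ?M * (i' + j' + k')) div ?M" by simp_all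
  then have "j + k = j' + k'" "i + j + k = i' + j' + k'"
    using lt by (simp_all only: mod_mult_self2 div_mult_self2 mod_less div_less)
  then show "q = q'" using g by (auto simp: q gamma_indices_def)
qed

lemma lead_coeff_monom_add:
  fixes q :: "'a::comm_ring_1 poly"
  assumes "degree q < m"
  shows "degree (monom 1 m + q) = m \<and> lead_coeff (monom 1 m + q) = 1"
proof -
  have "degree (monom 1 m + q) = m"
    using assms by (simp add: degree_add_eq_left degree_monom_eq)
  then show ?thesis using assms by (simp add: coeff_eq_0)
qed

lemma monic_power_product:
  fixes p q r :: "'a::idom poly"
  assumes "lead_coeff p = 1" "lead_coeff q = 1" "lead_coeff r = 1"
  shows "degree (p ^ i * q ^ j * r ^ k) = degree p * i + degree q * j + degree r * k \<and>
    lead_coeff (p ^ i * q ^ j * r ^ k) = 1"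
proof -
  have "p \<noteq> 0" "q \<noteq> 0" "r \<noteq> 0" using assms by auto
  then have "degree (p ^ i * q ^ j * r ^ k) = degree p * i + degree q * j + degree r * k"
    by (simp add: degree_mult_eq degree_power_eq mult.commute)
  moreover have "lead_coeff (p ^ i * q ^ j * r ^ k) = 1"
    unfolding lead_coeff_mult lead_coeff_power assms by simp
  ultimately show ?thesis ..
qed

text \<open>
  Substitute \<open>x = s ^ M\<close>, \<open>y = s\<close>, \<open>z = 1\<close> with \<open>M = 2 * n + 3\<close>. The elementary symmetric polynomials
  become monic in \<open>s\<close> of degrees \<open>M\<close>, \<open>M + 1\<close>, \<open>M + 1\<close>, so their monomials become monic polynomials whose
  degrees are pairwise distinct by \<open>inj_on_gamma_degree\<close>. A linear combination that vanishes
  at every integer \<open>s\<close> is the zero polynomial, and its leading term is the one of largest degree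
  with a nonzero coefficient: there is none.
\<close>

lemma elementary_symmetric_independent:
  fixes c :: "nat \<times> nat \<times> nat \<Rightarrow> int"
  assumes "\<And>x y z :: int. (\<Sum>(i, j, k)\<in>gamma_indices n.
      c (i, j, k) * (x + y + z) ^ i * (x * y + y * z + z * x) ^ j * (x * y * z) ^ k) = 0"
    and "q \<in> gamma_indices n"
  shows "c q = 0"
proof (rule ccontr)
  assume "c q \<noteq> 0"
  let ?M = "2 * n + 3"
  define S where "S = {q \<in> gamma_indices n. c q \<noteq> 0}"
  define D where "D = (\<lambda>(i, j, k). ?M * i + (2 * n + 4) * j + (2 * n + 4) * k)"
  define E1 E2 E3 :: "int poly" where "E1 = monom 1 ?M + (monom 1 1 + 1)"
    and "E2 = monom 1 (2 * n + 4) + (monom 1 1 + monom 1 ?M)" and "E3 = monom 1 (2 * n + 4)"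
  define mon where "mon = (\<lambda>(i, j, k). E1 ^ i * E2 ^ j * E3 ^ k)"
  define P where "P = (\<Sum>q\<in>gamma_indices n. smult (c q) (mon q))"
  have "degree (monom (1::int) 1 + 1) < ?M"
    by (rule degree_add_less) (simp_all add: degree_monom_eq)
  then have E1: "degree E1 = ?M \<and> lead_coeff E1 = 1" unfolding E1_def by (rule lead_coeff_monom_add)
  have "degree (monom (1::int) 1 + monom 1 ?M) < 2 * n + 4"
    by (rule degree_add_less) (simp_all add: degree_monom_eq)
  then have E2: "degree E2 = 2 * n + 4 \<and> lead_coeff E2 = 1" unfolding E2_def by (rule lead_coeff_monom_add)
  have E3: "degree E3 = 2 * n + 4 \<and> lead_coeff E3 = 1" by (simp add: E3_def degree_monom_eq)
  have mon: "degree (mon q) = D q \<and> lead_coeff (mon q) = 1" for q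
  proof -
    obtain i j k where q: "q = (i, j, k)" by (cases q)
    show ?thesis
      using monic_power_product[OF E1[THEN conjunct2] E2[THEN conjunct2] E3[THEN conjunct2], of i j k]
      unfolding E1[THEN conjunct1] E2[THEN conjunct1] E3[THEN conjunct1] q mon_def D_def prod.case .
  qed
  have "poly P s = 0" for s
  proof -
    have "poly (mon (i, j, k)) s = (s ^ ?M + s + 1) ^ i * (s ^ ?M * s + s * 1 + 1 * s ^ ?M) ^ j * (s ^ ?M * s * 1) ^ k"
      for i j k
      by (simp add: mon_def E1_def E2_def E3_def poly_monom poly_power add_ac mult_ac eval_nat_numeral)
    then have "poly P s = (\<Sum>(i, j, k)\<in>gamma_indices n. c (i, j, k) *
        (s ^ ?M + s + 1) ^ i * (s ^ ?M * s + s * 1 + 1 * s ^ ?M) ^ j * (s ^ ?M * s * 1) ^ k)"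
      unfolding P_def poly_sum poly_smult by (intro sum.cong refl) (auto simp: mult.assoc)
    then show ?thesis using assms(1)[of "s ^ ?M" s 1] by (simp only:)
  qed
  then have P: "P = 0" using poly_all_0_iff_0 by blast
  have fin: "finite S" using finite_gamma_indices by (simp add: S_def)
  have "q \<in> S" using assms(2) \<open>c q \<noteq> 0\<close> by (simp add: S_def)
  then have "Max (D ` S) \<in> D ` S" using fin by (intro Max_in) auto
  then obtain m where m: "m \<in> S" "D m = Max (D ` S)" by auto
  have small: "c q' * coeff (mon q') (D m) = 0" if "q' \<in> gamma_indices n - {m}" for q'
  proof (cases "c q' = 0")
    case False
    then have q': "q' \<in> S" using that by (simp add: S_def)
    then have "D q' \<le> D m" using fin m(2) by simp
    moreover have "D q' \<noteq> D m"
      using inj_onD[OF inj_on_gamma_degree[of n], folded D_def, of q' m] q' m(1) that by (auto simp: S_def)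
    ultimately have "degree (mon q') < D m" using mon[of q'] by simp
    then show ?thesis by (simp add: coeff_eq_0)
  qed simp
  have "coeff P (D m) = (\<Sum>q\<in>gamma_indices n. c q * coeff (mon q) (D m))"
    by (simp add: P_def coeff_sum)
  also have "\<dots> = c m * coeff (mon m) (D m) + (\<Sum>q\<in>gamma_indices n - {m}. c q * coeff (mon q) (D m))"
    using m(1) by (intro sum.remove finite_gamma_indices) (simp add: S_def)
  also have "\<dots> = c m"
  proof -
    have "coeff (mon m) (D m) = 1" using mon[of m] by metis
    then show ?thesis using small by (simp add: sum.neutral)
  qed
  finally show False using P m(1) by (simp add: S_def)
qed

theorem theorem22:
  fixes n :: nat
  assumes "n \<ge> 1"
  shows "(\<exists>!\<gamma>. gamma_coeffs n \<gamma>) \<and>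
    (\<forall>\<gamma>. gamma_coeffs n \<gamma> \<longrightarrow>
      (\<forall>x y z :: 'a::comm_ring_1.
         N_poly n x y z =
           (\<Sum>(i, j, k)\<in>gamma_indices n.
              3 ^ i * of_int (\<gamma> i j k) * (x + y + z) ^ j * (x * y * z) ^ k)) \<and>
      (\<forall>i j k. i + 2 * j + 3 * k = 2 * n + 1 \<longrightarrow>
         \<gamma> i j k = int (card {t \<in> trees_0123 n.
            num_degree 0 t = k \<and> num_degree 1 t = j \<and> num_degree 2 t = i})))"
proof -
  define g :: "nat \<Rightarrow> nat \<Rightarrow> nat \<Rightarrow> int" where
    "g = (\<lambda>i j k. if (i, j, k) \<in> gamma_indices n then int (tree_count n i j k) else 0)"
  have g_coeffs: "gamma_coeffs n g"
    unfolding gamma_coeffs_def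
  proof (intro conjI allI impI)
    fix x y z :: int
    show "C_poly n x y z = (\<Sum>(i, j, k)\<in>gamma_indices n.
        g i j k * (x + y + z) ^ i * (x * y + y * z + z * x) ^ j * (x * y * z) ^ k)"
      unfolding C_poly_expansion[OF assms] by (intro sum.cong refl) (auto simp: g_def)
  qed (simp add: g_def)
  have uniq: "\<gamma> = g" if \<gamma>: "gamma_coeffs n \<gamma>" for \<gamma>
  proof (intro ext)
    fix i j k
    show "\<gamma> i j k = g i j k"
    proof (cases "(i, j, k) \<in> gamma_indices n")
      case True
      let ?c = "\<lambda>(i, j, k). \<gamma> i j k - g i j k"
      have "?c (i, j, k) = 0"
      proof (rule elementary_symmetric_independent[OF _ True])
        fix x y z :: int
        have "(\<Sum>(i, j, k)\<in>gamma_indices n.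
            ?c (i, j, k) * (x + y + z) ^ i * (x * y + y * z + z * x) ^ j * (x * y * z) ^ k) =
            C_poly n x y z - C_poly n x y z"
        proof -
          have "C_poly n x y z - C_poly n x y z =
              (\<Sum>(i, j, k)\<in>gamma_indices n.
                \<gamma> i j k * (x + y + z) ^ i * (x * y + y * z + z * x) ^ j * (x * y * z) ^ k) -
              (\<Sum>(i, j, k)\<in>gamma_indices n.
                g i j k * (x + y + z) ^ i * (x * y + y * z + z * x) ^ j * (x * y * z) ^ k)"
            using \<gamma> g_coeffs unfolding gamma_coeffs_def by (intro arg_cong2[of _ _ _ _ minus]) blast+
          then show ?thesis
            by (simp add: sum_subtractf[symmetric] case_prod_unfold left_diff_distrib)
        qed
        then show "(\<Sum>(i, j, k)\<in>gamma_indices n.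
            ?c (i, j, k) * (x + y + z) ^ i * (x * y + y * z + z * x) ^ j * (x * y * z) ^ k) = 0" by simp
      qed
      then show ?thesis by simp
    next
      case False
      then show ?thesis using \<gamma> g_coeffs unfolding gamma_coeffs_def by simp
    qed
  qed
  have "N_poly n x y z = (\<Sum>(i, j, k)\<in>gamma_indices n.
      3 ^ i * of_int (g i j k) * (x + y + z) ^ j * (x * y * z) ^ k)" for x y z :: 'a
    unfolding N_poly_expansion[OF assms] by (intro sum.cong refl) (auto simp: g_def mult_ac)
  moreover have "g i j k = int (card {t \<in> trees_0123 n.
      num_degree 0 t = k \<and> num_degree 1 t = j \<and> num_degree 2 t = i})"
    if "i + 2 * j + 3 * k = 2 * n + 1" for i j k
    using that by (simp add: g_def gamma_indices_def tree_count_def)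
  ultimately show ?thesis using g_coeffs uniq by blast
qed

end
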